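(* Let $G$ be a finite group. Let $\mathcal{H}_G=\{\operatorname{Ker}\rho\mid \rho\in\operatorname{Irr}(G)\}$, let $\underline{\mathcal{H}}_G=\mathcal{H}_G\sqcup\{\emptyset\}$, partially ordered by inclusion, and let $\mu\colon\underline{\mathcal{H}}_G\times\underline{\mathcal{H}}_G\to\mathbb{Z}$ be the Möbius function of this finite partially ordered set. Then, for any $G$-cover $Y/X$ of finite connected graphs, we have \[ \kappa(Y)=\frac{1}{|G|}\left(\prod_{v\in V_X}m_v(Y/X)\right)\prod_{H\in\mathcal{H}_G}\left(\frac{[G:H]\,\kappa(X_H)}{f_H(Y/X)}\right)^{-\mu(\emptyset,H)}. \]
   Context: **Graphs.** A graph $X=(V_X,E_X,o,t,\iota)$ consists of a set $V_X$ of vertices, a set $E_X$ of (directed) edges, maps $o,t\colon E_X\to V_X$ (origin, terminus) and a fixed-point-free involution $\iota\colon e\mapsto\bar e$ of $E_X$ with $o(\bar e)=t(e)$. All graphs here are finite; loops and multiple edges are allowed, and an undirected edge is a pair $\{e,\bar e\}$. For $v\in V_X$ let $E_X^v=\{e\in E_X\mid o(e)=v\}$. For a finite connected graph $X$, $\kappa(X)$ is its number of spanning trees (of the underlying undirected multigraph). A morphism of graphs is a pair of maps on vertices and edges compatible with $o$, $t$ and $e\mapsto\bar e$. **Covers.** Let $X,Y$ be finite connected graphs. A morphism $\pi=(\pi_V,\pi_E)\colon Y\to X$ is a cover if $\pi_V,\pi_E$ are surjective and for each $w\in V_Y$ there is a positive integer $m_w(Y/X)$ (the ramification index at $w$) such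 that $\pi_E\colon E_Y^w\to E_X^{\pi_V(w)}$ is $m_w(Y/X)$-to-$1$ (every fiber has exactly $m_w(Y/X)$ elements); by convention the empty map $\emptyset\to\emptyset$ is $1$-to-$1$, i.e. $m_w=1$ in that case. **$G$-covers.** For a finite group $G$, a cover $\pi\colon Y\to X$ is a $G$-cover (written $Y/X$) if $G$ acts faithfully on $Y$ by graph automorphisms, each fiber of $\pi_V$ and of $\pi_E$ is $G$-stable, $G$ acts transitively on each fiber of $\pi_V$, and $G$ acts freely and transitively on each fiber of $\pi_E$. Then $m_w(Y/X)=|\operatorname{Stab}_G(w)|$ is constant on vertex fibers; for $v\in V_X$ put $m_v(Y/X)=m_w(Y/X)$ for any $w\in\pi_V^{-1}(v)$. For a subgroup $H\subseteq G$, $X_H=H\backslash Y$ is the quotient graph (vertex set $H\backslash V_Y$, edge set $H\backslash E_Y$, induced structure maps); the natural map $Y\to X_H$ is an $H$-cover. **Ramification factor.** For a subgroup $H\subseteq G$, \[ f_H(Y/X)=\frac{\prod_{v\in V_X}m_v(Y/X)}{\prod_{x\in V_{X_H}}m_x(Y/X_H)}. \] **Representations and posets.** $\operatorname{Irr}(G)$ is the set of (isomorphism classes of) irreducible finite-dimensional complex representations of $G$. In $\underline{\mathcal{H}}_G$ the symbol $\emptyset$ is the empty set, so it is the least element. The Möbius function of a finite poset $\mathcal{L}$ is defined by $\mu(x,x)=1$, $\mu(x,y)=-\sum_{x\le z<y}\mu(x,z)$ if $x<y$, and $\mu(x,y)=0$ otherwise. *)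

theory Defs
  imports
    Complex_Main
    "HOL-Algebra.Group_Action"
    "Graph_Theory.Graph_Theory"
    "Jordan_Normal_Form.VS_Connect"
begin

text \<open>
  A graph with origin and terminus maps and a fixed-point-free edge involution is a
  \<open>bidirected_digraph\<close>: \<open>tail\<close> is the origin, \<open>head\<close> the terminus, and the
  involution \<open>arev\<close> is extended by the identity outside the set of arcs.
\<close>

locale finite_connected_graph = fin_digraph X + bidirected_digraph X arev
  for X :: "('v, 'e) pre_digraph" and arev +
  assumes connected: "Digraph_Component.connected X"

text \<open>
  The predicate \<open>tree\<close> of the graph library is about directed graphs: a forest there
  has no directed cycle, so a single undirected edge, i.e. a pair of mutually
  reverse arcs, is already excluded.  Here a spanning tree is a connected spanning
  subgraph, closed under the involution, without an undirected cycle, i.e. without a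
  cycle that avoids using both orientations of the same edge.  Loops and pairs of
  parallel edges do give such cycles.
\<close>

definition undirected_acyclic :: "('v, 'e) pre_digraph \<Rightarrow> ('e \<Rightarrow> 'e) \<Rightarrow> bool" where
  "undirected_acyclic T arev \<longleftrightarrow>
     \<not> (\<exists>p. pre_digraph.cycle T p \<and> (\<forall>a \<in> set p. arev a \<notin> set p))"

definition spanning_trees :: "('v, 'e) pre_digraph \<Rightarrow> ('e \<Rightarrow> 'e) \<Rightarrow> ('v, 'e) pre_digraph set" where
  "spanning_trees X arev =
     {T. spanning T X \<and> arev ` arcs T \<subseteq> arcs T \<and>
         Digraph_Component.connected T \<and> undirected_acyclic T arev}"

definition kappa :: "('v, 'e) pre_digraph \<Rightarrow> ('e \<Rightarrow> 'e) \<Rightarrow> nat" where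
  "kappa X arev = card (spanning_trees X arev)"

locale graph_morphism =
  Y: bidirected_digraph Y revY + X: bidirected_digraph X revX
  for Y :: "('w, 'f) pre_digraph" and revY
    and X :: "('v, 'e) pre_digraph" and revX
    and piV :: "'w \<Rightarrow> 'v" and piE :: "'f \<Rightarrow> 'e" +
  assumes piV_verts: "w \<in> verts Y \<Longrightarrow> piV w \<in> verts X"
    and piE_arcs: "a \<in> arcs Y \<Longrightarrow> piE a \<in> arcs X"
    and tail_piE: "a \<in> arcs Y \<Longrightarrow> tail X (piE a) = piV (tail Y a)"
    and head_piE: "a \<in> arcs Y \<Longrightarrow> head X (piE a) = piV (head Y a)"
    and rev_piE: "a \<in> arcs Y \<Longrightarrow> revX (piE a) = piE (revY a)"

definition is_ramification_index ::
  "('w, 'f) pre_digraph \<Rightarrow> ('v, 'e) pre_digraph \<Rightarrow> ('w \<Rightarrow> 'v) \<Rightarrow> ('f \<Rightarrow> 'e) \<Rightarrow> 'w \<Rightarrow> nat \<Rightarrow> bool"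
where
  "is_ramification_index Y X piV piE w m \<longleftrightarrow>
     0 < m \<and>
     (\<forall>e \<in> out_arcs X (piV w). card {f \<in> out_arcs Y w. piE f = e} = m) \<and>
     (out_arcs X (piV w) = {} \<longrightarrow> m = 1)"

locale graph_cover =
  Y: finite_connected_graph Y revY + X: finite_connected_graph X revX +
  graph_morphism Y revY X revX piV piE
  for Y :: "('w, 'f) pre_digraph" and revY
    and X :: "('v, 'e) pre_digraph" and revX
    and piV :: "'w \<Rightarrow> 'v" and piE :: "'f \<Rightarrow> 'e" +
  assumes piV_surj: "piV ` verts Y = verts X"
    and piE_surj: "piE ` arcs Y = arcs X"
    and ramified: "w \<in> verts Y \<Longrightarrow> \<exists>m. is_ramification_index Y X piV piE w m"

definition ramification_index ::
  "('w, 'f) pre_digraph \<Rightarrow> ('v, 'e) pre_digraph \<Rightarrow> ('w \<Rightarrow> 'v) \<Rightarrow> ('f \<Rightarrow> 'e) \<Rightarrow> 'w \<Rightarrow> nat"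
where
  "ramification_index Y X piV piE w = (THE m. is_ramification_index Y X piV piE w m)"

text \<open>
  The index at a vertex of the base is that of any vertex above it; for the covers
  below it does not depend on the choice.
\<close>

definition base_ramification_index ::
  "('w, 'f) pre_digraph \<Rightarrow> ('v, 'e) pre_digraph \<Rightarrow> ('w \<Rightarrow> 'v) \<Rightarrow> ('f \<Rightarrow> 'e) \<Rightarrow> 'v \<Rightarrow> nat"
where
  "base_ramification_index Y X piV piE v =
     ramification_index Y X piV piE (SOME w. w \<in> verts Y \<and> piV w = v)"

text \<open>
  The group acts through \<open>phiV\<close> on the vertices and through \<open>phiE\<close> on the edges of \<open>Y\<close>;
  faithfulness concerns the two actions jointly.
\<close>

locale galois_cover =
  graph_cover Y revY X revX piV piE +
  actV: group_action G "verts Y" phiV + actE: group_action G "arcs Y" phiE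
  for G :: "('g, 'm) monoid_scheme" (structure)
    and Y :: "('w, 'f) pre_digraph" and revY
    and X :: "('v, 'e) pre_digraph" and revX
    and piV :: "'w \<Rightarrow> 'v" and piE :: "'f \<Rightarrow> 'e"
    and phiV :: "'g \<Rightarrow> 'w \<Rightarrow> 'w" and phiE :: "'g \<Rightarrow> 'f \<Rightarrow> 'f" +
  assumes act_tail: "\<lbrakk>g \<in> carrier G; a \<in> arcs Y\<rbrakk> \<Longrightarrow> tail Y (phiE g a) = phiV g (tail Y a)"
    and act_head: "\<lbrakk>g \<in> carrier G; a \<in> arcs Y\<rbrakk> \<Longrightarrow> head Y (phiE g a) = phiV g (head Y a)"
    and act_rev: "\<lbrakk>g \<in> carrier G; a \<in> arcs Y\<rbrakk> \<Longrightarrow> revY (phiE g a) = phiE g (revY a)"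
    and faithful:
      "\<lbrakk>g \<in> carrier G; \<forall>w \<in> verts Y. phiV g w = w; \<forall>a \<in> arcs Y. phiE g a = a\<rbrakk> \<Longrightarrow> g = \<one>"
    and piV_stable: "\<lbrakk>g \<in> carrier G; w \<in> verts Y\<rbrakk> \<Longrightarrow> piV (phiV g w) = piV w"
    and piE_stable: "\<lbrakk>g \<in> carrier G; a \<in> arcs Y\<rbrakk> \<Longrightarrow> piE (phiE g a) = piE a"
    and piV_transitive:
      "\<lbrakk>w \<in> verts Y; w' \<in> verts Y; piV w = piV w'\<rbrakk> \<Longrightarrow> \<exists>g \<in> carrier G. phiV g w = w'"
    and piE_transitive:
      "\<lbrakk>a \<in> arcs Y; a' \<in> arcs Y; piE a = piE a'\<rbrakk> \<Longrightarrow> \<exists>g \<in> carrier G. phiE g a = a'"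
    and piE_free: "\<lbrakk>g \<in> carrier G; a \<in> arcs Y; phiE g a = a\<rbrakk> \<Longrightarrow> g = \<one>"

text \<open>
  The quotient graph.  Since the action commutes with the structure maps, the image of
  an orbit of edges under \<open>tail Y\<close>, \<open>head Y\<close> or \<open>revY\<close> is again an orbit, namely the
  orbit of the image of any representative.
\<close>

definition quotient_graph ::
  "('g, 'm) monoid_scheme \<Rightarrow> ('g \<Rightarrow> 'w \<Rightarrow> 'w) \<Rightarrow> ('g \<Rightarrow> 'f \<Rightarrow> 'f) \<Rightarrow>
   ('w, 'f) pre_digraph \<Rightarrow> ('w set, 'f set) pre_digraph"
where
  "quotient_graph K phiV phiE Y =
     \<lparr>verts = orbits K (verts Y) phiV, arcs = orbits K (arcs Y) phiE,
      tail = (\<lambda>A. tail Y ` A), head = (\<lambda>A. head Y ` A)\<rparr>"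

definition quotient_rev ::
  "('g, 'm) monoid_scheme \<Rightarrow> ('g \<Rightarrow> 'f \<Rightarrow> 'f) \<Rightarrow>
   ('w, 'f) pre_digraph \<Rightarrow> ('f \<Rightarrow> 'f) \<Rightarrow> 'f set \<Rightarrow> 'f set"
where
  "quotient_rev K phiE Y revY A = (if A \<in> orbits K (arcs Y) phiE then revY ` A else A)"

definition kappa_quotient ::
  "('g, 'm) monoid_scheme \<Rightarrow> ('g \<Rightarrow> 'w \<Rightarrow> 'w) \<Rightarrow> ('g \<Rightarrow> 'f \<Rightarrow> 'f) \<Rightarrow>
   ('w, 'f) pre_digraph \<Rightarrow> ('f \<Rightarrow> 'f) \<Rightarrow> 'g set \<Rightarrow> nat"
where
  "kappa_quotient G phiV phiE Y revY H =
     (let K = G\<lparr>carrier := H\<rparr>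
      in kappa (quotient_graph K phiV phiE Y) (quotient_rev K phiE Y revY))"

definition ramification_factor ::
  "('g, 'm) monoid_scheme \<Rightarrow> ('w, 'f) pre_digraph \<Rightarrow> ('v, 'e) pre_digraph \<Rightarrow>
   ('w \<Rightarrow> 'v) \<Rightarrow> ('f \<Rightarrow> 'e) \<Rightarrow> ('g \<Rightarrow> 'w \<Rightarrow> 'w) \<Rightarrow> ('g \<Rightarrow> 'f \<Rightarrow> 'f) \<Rightarrow> 'g set \<Rightarrow> real"
where
  "ramification_factor G Y X piV piE phiV phiE H =
     (let K = G\<lparr>carrier := H\<rparr>; XH = quotient_graph K phiV phiE Y
      in (\<Prod>v \<in> verts X. real (base_ramification_index Y X piV piE v)) /
         (\<Prod>x \<in> verts XH. real (base_ramification_index Y XH (Group_Action.orbit K phiV) (Group_Action.orbit K phiE) x)))"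

text \<open>
  Every finite-dimensional complex representation is isomorphic to one on some
  \<open>\<complex>\<^sup>n\<close>, and isomorphic representations have the same kernel.
\<close>

definition GL :: "nat \<Rightarrow> complex mat monoid" where
  "GL n = units_of (ring_mat TYPE(complex) n ())"

definition irreducible_rep :: "('g, 'm) monoid_scheme \<Rightarrow> nat \<Rightarrow> ('g \<Rightarrow> complex mat) \<Rightarrow> bool" where
  "irreducible_rep G n rho \<longleftrightarrow>
     rho \<in> hom G (GL n) \<and> 0 < n \<and>
     (\<forall>W. VectorSpace.subspace class_ring W (module_vec TYPE(complex) n) \<and>
          (\<forall>g \<in> carrier G. \<forall>w \<in> W. rho g *\<^sub>v w \<in> W)
        \<longrightarrow> W = {0\<^sub>v n} \<or> W = carrier_vec n)"

definition irr_kernels :: "('g, 'm) monoid_scheme \<Rightarrow> 'g set set" where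
  "irr_kernels G = {Coset.kernel G (GL n) rho | n rho. irreducible_rep G n rho}"

text \<open>The Moebius function of a finite subset \<open>P\<close> of a partially ordered type.\<close>

function moebius_poset :: "'a::order set \<Rightarrow> 'a \<Rightarrow> 'a \<Rightarrow> int" where
  "moebius_poset P x y =
     (if x = y then 1
      else if finite P \<and> x < y then - (\<Sum>z \<in> {z \<in> P. x \<le> z \<and> z < y}. moebius_poset P x z)
      else 0)"
  by pat_completeness auto
termination
proof (relation "Wellfounded.measure (\<lambda>(P, x, y). card {z \<in> P. z < y})", goal_cases)
  case 1
  then show ?case by simp
next
  case (2 P x y z)
  then have "{u \<in> P. u < z} \<subset> {u \<in> P. u < y}"
    by (auto dest: less_trans)
  with 2 show ?case
    by (auto intro!: psubset_card_mono)
qed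

declare moebius_poset.simps [simp del]

end

theory Submission
  imports
    Defs
    "Jordan_Normal_Form.Schur_Decomposition"
    "HOL-Library.Function_Algebras"
begin

text \<open>
  Let \<open>L\<close> be the Laplacian of \<open>Y\<close>.  For a normal subgroup \<open>H\<close>, the restriction of \<open>L\<close> to
  the \<open>H\<close>-invariant functions is the Laplacian of \<open>X\<^sub>H\<close> with row \<open>x\<close> multiplied by
  \<open>m\<^sub>x(Y/X\<^sub>H)\<close>.  By the matrix tree theorem \<open>0\<close> is a simple eigenvalue of this matrix, and
  since \<open>m\<^sub>x(Y/X\<^sub>H)\<close> times the length of the orbit \<open>x\<close> is the order of \<open>H\<close>, the product of
  the nonzero eigenvalues is \<open>\<kappa>(X\<^sub>H) (\<Prod>\<^sub>x m\<^sub>x(Y/X\<^sub>H)) |V\<^sub>Y| / |H|\<close>.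

  Write \<open>e\<^sub>H\<close> for the average of the elements of \<open>H\<close>.  In the group algebra
  \<open>1 = - (\<Sum>\<^sub>H \<mu>(\<emptyset>, H) e\<^sub>H)\<close>, the sum running over the kernels of the irreducible
  representations: the difference \<open>x\<close> of both sides is self-adjoint and acts as zero on an
  irreducible representation with kernel \<open>K\<close>, because there \<open>e\<^sub>H\<close> is the identity if
  \<open>H \<subseteq> K\<close> and zero otherwise, and the Moebius values sum to \<open>-1\<close> below \<open>K\<close>.  If the image
  of \<open>x\<close> on the regular representation were nonzero, it would contain an irreducible
  subspace, which would be orthogonal to itself.

  Multiplying by \<open>L\<^sup>k\<close> and taking traces, the spectrum of \<open>L\<close> is the combination of the
  spectra for the subgroups \<open>H\<close> with multiplicities \<open>-\<mu>(\<emptyset>, H)\<close>, first for all power sums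
  and hence as multisets.  Comparing the multiplicities of \<open>0\<close> and the products of the
  nonzero eigenvalues gives the formula.
\<close>

section \<open>Spectra and power sums\<close>

text \<open>Determinants and Schur form need numeric indices; everything else stays indexed by
  vertices, and the enumeration \<open>e\<close> translates.\<close>

definition fun_mat :: "(nat \<Rightarrow> 'v) \<Rightarrow> nat \<Rightarrow> ('v \<Rightarrow> 'v \<Rightarrow> 'a) \<Rightarrow> 'a mat" where
  "fun_mat e n A = mat n n (\<lambda>(i, j). A (e i) (e j))"

lemma fun_mat_simps [simp]:
  "fun_mat e n A \<in> carrier_mat n n"
  "dim_row (fun_mat e n A) = n" "dim_col (fun_mat e n A) = n"
  "i < n \<Longrightarrow> j < n \<Longrightarrow> fun_mat e n A $$ (i, j) = A (e i) (e j)"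
  by (auto simp: fun_mat_def)

text \<open>Matrix powers without an enumeration of the index set, so that traces and orbit sums can
  be formed directly over vertices.\<close>

fun kernel_pow :: "'v set \<Rightarrow> ('v \<Rightarrow> 'v \<Rightarrow> 'a::comm_semiring_1) \<Rightarrow> nat \<Rightarrow> 'v \<Rightarrow> 'v \<Rightarrow> 'a" where
  "kernel_pow V A 0 x y = (if x = y then 1 else 0)"
| "kernel_pow V A (Suc k) x y = (\<Sum>z\<in>V. kernel_pow V A k x z * A z y)"

lemma fun_mat_pow:
  assumes e: "bij_betw e {0..<n} V"
  shows "fun_mat e n A ^\<^sub>m k = fun_mat e n (kernel_pow V A k)"
proof (induction k)
  case 0
  show ?case
    using e by (intro eq_matI) (auto simp: bij_betw_def inj_on_eq_iff)
next
  case (Suc k)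
  have "(\<Sum>l = 0..<n. kernel_pow V A k x (e l) * A (e l) y)
      = (\<Sum>z\<in>V. kernel_pow V A k x z * A z y)" for x y
    by (rule sum.reindex_bij_betw[OF e])
  then show ?case
    by (intro eq_matI) (auto simp: Suc scalar_prod_def)
qed

lemma trace_mult_comm:
  fixes A B :: "'a::comm_semiring_0 mat"
  assumes "A \<in> carrier_mat n n" "B \<in> carrier_mat n n"
  shows "(\<Sum>i = 0..<n. (A * B) $$ (i, i)) = (\<Sum>i = 0..<n. (B * A) $$ (i, i))"
proof -
  have "(\<Sum>i = 0..<n. (A * B) $$ (i, i)) = (\<Sum>i = 0..<n. \<Sum>j = 0..<n. A $$ (i, j) * B $$ (j, i))"
    using assms by (intro sum.cong) (auto simp: scalar_prod_def)
  also have "\<dots> = (\<Sum>j = 0..<n. \<Sum>i = 0..<n. A $$ (i, j) * B $$ (j, i))"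
    by (rule sum.swap)
  also have "\<dots> = (\<Sum>j = 0..<n. (B * A) $$ (j, j))"
    using assms by (intro sum.cong) (auto simp: scalar_prod_def mult.commute)
  finally show ?thesis .
qed

lemma upper_triangular_pow:
  fixes B :: "'a::comm_semiring_1 mat"
  assumes B: "B \<in> carrier_mat n n" "upper_triangular B"
  shows "upper_triangular (B ^\<^sub>m k) \<and> (\<forall>i<n. (B ^\<^sub>m k) $$ (i, i) = (B $$ (i, i)) ^ k)"
proof (induction k)
  case 0
  show ?case using B by auto
next
  case (Suc k)
  define C where "C = B ^\<^sub>m k"
  have C: "C \<in> carrier_mat n n" using B by (simp add: C_def)
  have Cut: "C $$ (i, j) = 0" if "j < i" "i < n" for i j
    using Suc that C by (auto simp: C_def[symmetric])
  have But: "B $$ (i, j) = 0" if "j < i" "i < n" for i j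
    using B that by auto
  have entry: "(C * B) $$ (i, j) = (\<Sum>l = 0..<n. C $$ (i, l) * B $$ (l, j))" if "i < n" "j < n" for i j
    using that B C by (auto simp: scalar_prod_def)
  have "(C * B) $$ (i, j) = 0" if "j < i" "i < n" for i j
  proof -
    have "C $$ (i, l) * B $$ (l, j) = 0" if "l < n" for l
      using Cut[of l i] But[of j l] that \<open>j < i\<close> \<open>i < n\<close> by (cases "l < i") auto
    then show ?thesis using entry that by auto
  qed
  moreover have "(C * B) $$ (i, i) = (B $$ (i, i)) ^ Suc k" if "i < n" for i
  proof -
    have "C $$ (i, l) * B $$ (l, i) = 0" if "l < n" "l \<noteq> i" for l
      using Cut[of l i] But[of i l] that \<open>i < n\<close> by (cases "l < i") auto
    then have "(\<Sum>l = 0..<n. C $$ (i, l) * B $$ (l, i)) = (\<Sum>l\<in>{i}. C $$ (i, l) * B $$ (l, i))"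
      using that by (intro sum.mono_neutral_right) auto
    then show ?thesis using Suc that entry by (simp add: C_def[symmetric] mult.commute)
  qed
  ultimately show ?case using B C by (auto simp: C_def[symmetric])
qed

lemma poly_char_poly:
  fixes A :: "'a::field mat"
  assumes "A \<in> carrier_mat n n"
  shows "poly (char_poly A) t = det (t \<cdot>\<^sub>m 1\<^sub>m n - A)"
  unfolding char_poly_def
  by (rule poly_det_cong[of _ n]) (use assms in \<open>auto simp: char_poly_matrix_def\<close>)

text \<open>Schur decomposition makes the matrix upper triangular, and \<open>S\<close> collects the
  diagonal. Conjugation changes neither determinant nor trace, and the diagonal of a power of a
  triangular matrix consists of the powers. One multiset thus serves both the determinant and all
  power sums.\<close>

lemma spectrum_fun_mat:
  fixes A :: "'v \<Rightarrow> 'v \<Rightarrow> complex"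
  assumes e: "bij_betw e {0..<n} V"
  obtains S :: "complex multiset" where
    "\<And>t. det (fun_mat e n (\<lambda>x y. (if x = y then t else 0) + A x y)) = (\<Prod>a\<in>#S. t + a)"
    "\<And>k. (\<Sum>x\<in>V. kernel_pow V A k x x) = (\<Sum>a\<in>#S. a ^ k)"
proof -
  define M where "M = fun_mat e n A"
  have M: "M \<in> carrier_mat n n" by (simp add: M_def)
  obtain as where as: "char_poly M = (\<Prod>a\<leftarrow>as. [:- a, 1:])" and len: "length as = n"
    using char_poly_factorized[OF M] by auto
  obtain B P Q where "schur_decomposition M as = (B, P, Q)"
    by (cases "schur_decomposition M as")
  from schur_decomposition[OF M as this]
  have sim: "similar_mat_wit M B P Q" and ut: "upper_triangular B" and diag: "diag_mat B = as"
    by auto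
  have B: "B \<in> carrier_mat n n" and P: "P \<in> carrier_mat n n" and Q: "Q \<in> carrier_mat n n"
    and PQ: "Q * P = 1\<^sub>m n"
    using similar_mat_witD2[OF M sim] by auto
  show thesis
  proof
    fix t
    \<comment> \<open>The characteristic polynomial is taken at -t; the sign from factoring -1 out
      of the n rows turns each factor -t - a into t + a.\<close>
    have "fun_mat e n (\<lambda>x y. (if x = y then t else 0) + A x y) = (- 1) \<cdot>\<^sub>m ((- t) \<cdot>\<^sub>m 1\<^sub>m n - M)"
      using e by (intro eq_matI) (auto simp: M_def bij_betw_def inj_on_eq_iff)
    then have "det (fun_mat e n (\<lambda>x y. (if x = y then t else 0) + A x y))
        = (- 1) ^ n * poly (char_poly M) (- t)"
      using poly_char_poly[OF M] carrier_matD[OF M] by simp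
    also have "\<dots> = (\<Prod>a\<in>#mset as. t + a)"
      unfolding as len[symmetric] by (induction as) (auto simp: algebra_simps)
    finally show "det (fun_mat e n (\<lambda>x y. (if x = y then t else 0) + A x y)) = (\<Prod>a\<in>#mset as. t + a)" .
  next
    fix k
    have Bk: "B ^\<^sub>m k \<in> carrier_mat n n" using B by simp
    have "(\<Sum>x\<in>V. kernel_pow V A k x x) = (\<Sum>i = 0..<n. (M ^\<^sub>m k) $$ (i, i))"
      using sum.reindex_bij_betw[OF e, of "\<lambda>x. kernel_pow V A k x x"]
      by (simp add: M_def fun_mat_pow[OF e])
    also have "M ^\<^sub>m k = P * (B ^\<^sub>m k) * Q"
      by (rule similar_mat_wit_pow_id[OF sim])
    also have "\<dots> = P * ((B ^\<^sub>m k) * Q)"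
      using assoc_mult_mat[OF P Bk Q] .
    also have "(\<Sum>i = 0..<n. (P * ((B ^\<^sub>m k) * Q)) $$ (i, i)) = (\<Sum>i = 0..<n. (((B ^\<^sub>m k) * Q) * P) $$ (i, i))"
      using P Q Bk by (intro trace_mult_comm) auto
    also have "((B ^\<^sub>m k) * Q) * P = B ^\<^sub>m k"
      by (simp only: assoc_mult_mat[OF Bk Q P] PQ right_mult_one_mat[OF Bk])
    also have "(\<Sum>i = 0..<n. (B ^\<^sub>m k) $$ (i, i)) = (\<Sum>i = 0..<n. (B $$ (i, i)) ^ k)"
      using upper_triangular_pow[OF B ut] by (intro sum.cong) auto
    also have "\<dots> = (\<Sum>a\<leftarrow>as. a ^ k)"
      unfolding diag[symmetric] using B
      by (simp add: diag_mat_def interv_sum_list_conv_sum_set_nat o_def)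
    also have "\<dots> = (\<Sum>a\<in>#mset as. a ^ k)"
      by (simp flip: mset_map sum_mset_sum_list)
    finally show "(\<Sum>x\<in>V. kernel_pow V A k x x) = (\<Sum>a\<in>#mset as. a ^ k)" .
  qed
qed

text \<open>At t = 0 the right side vanishes, so \<open>S\<close> contains 0. After cancelling t,
  evaluation at 0 gives c as the product of the remaining elements, and c being nonzero excludes a
  second 0.\<close>

lemma prod_shift_linear_coeff:
  fixes S :: "complex multiset"
  assumes eq: "\<And>t. (\<Prod>a\<in>#S. t + a) = t * (c + t * poly q t)" and "c \<noteq> 0"
  shows "count S 0 = 1" and "(\<Prod>a\<in>#filter_mset (\<lambda>a. a \<noteq> 0) S. a) = c"
proof -
  define P :: "complex multiset \<Rightarrow> complex poly" where "P S = (\<Prod>a\<in>#S. [:a, 1:])" for S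
  have polyP: "poly (P S) t = (\<Prod>a\<in>#S. t + a)" for S t
    by (induction S) (auto simp: P_def algebra_simps)
  have "poly (P S) t = poly ([:0, 1:] * ([:c:] + [:0, 1:] * q)) t" for t
    using eq[of t] by (simp add: polyP)
  \<comment> \<open>Equality of values is lifted to equality of polynomials, because t has to be
    cancelled before evaluating at 0 once more.\<close>
  then have PS: "P S = [:0, 1:] * ([:c:] + [:0, 1:] * q)"
    by (simp add: poly_eq_poly_eq_iff[symmetric] fun_eq_iff del: mult_pCons_left)
  have "(\<Prod>a\<in>#S. a) = 0"
    using eq[of 0] by simp
  then have "0 \<in># S" by auto
  then obtain T where T: "S = add_mset 0 T"
    by (metis multi_member_split)
  have "P S = [:0, 1:] * P T" by (simp add: T P_def)
  with PS have "P T = [:c:] + [:0, 1:] * q"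
    by (metis mult_cancel_left pCons_eq_0_iff zero_neq_one)
  then have prodT: "(\<Prod>a\<in>#T. a) = c"
    using polyP[of T 0] by simp
  with \<open>c \<noteq> 0\<close> have T0: "0 \<notin># T" by auto
  then show "count S 0 = 1" by (simp add: T not_in_iff)
  have "filter_mset (\<lambda>a. a \<noteq> 0) S = T"
    using T0 by (auto simp: T filter_mset_eq_conv)
  then show "(\<Prod>a\<in>#filter_mset (\<lambda>a. a \<noteq> 0) S. a) = c"
    using prodT by simp
qed

section \<open>Power sums determine multiplicities\<close>

text \<open>By linearity the sums vanish for every polynomial in place of a power, in particular for
  one whose roots are the points of \<open>U\<close> other than b. The exponent k = 0, with 0 ^ 0 =
  1, is what reaches the coefficient at 0.\<close>

lemma power_sums_determine_coeffs:
  fixes c :: "complex \<Rightarrow> complex"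
  assumes fin: "finite U" and sums: "\<And>k. (\<Sum>a\<in>U. c a * a ^ k) = 0" and b: "b \<in> U"
  shows "c b = 0"
proof -
  have poly_sum_0: "(\<Sum>a\<in>U. c a * poly p a) = 0" for p
  proof -
    have "(\<Sum>a\<in>U. c a * poly p a) = (\<Sum>a\<in>U. \<Sum>i\<le>degree p. coeff p i * (c a * a ^ i))"
      by (simp add: poly_altdef sum_distrib_left mult_ac)
    also have "\<dots> = (\<Sum>i\<le>degree p. coeff p i * (\<Sum>a\<in>U. c a * a ^ i))"
      by (subst sum.swap) (simp add: sum_distrib_left)
    finally show ?thesis by (simp add: sums)
  qed
  define p where "p = (\<Prod>a\<in>U - {b}. [:- a, 1:])"
  have "(\<Sum>a\<in>U. c a * poly p a) = (\<Sum>a\<in>{b}. c a * poly p a)"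
    using fin b by (intro sum.mono_neutral_right) (auto simp: p_def poly_prod prod_zero_iff)
  then have "c b * poly p b = 0" using poly_sum_0 by simp
  moreover have "poly p b \<noteq> 0" using fin by (auto simp: p_def poly_prod)
  ultimately show ?thesis by simp
qed

lemma power_int_sum:
  fixes x :: "'a::field"
  assumes "x \<noteq> 0"
  shows "x powi (\<Sum>i\<in>I. f i) = (\<Prod>i\<in>I. x powi f i)"
  using assms by (induction I rule: infinite_finite_induct) (auto simp: power_int_add)

lemma power_int_prod_distrib:
  fixes f :: "'b \<Rightarrow> 'a::field"
  shows "(\<Prod>a\<in>A. f a) powi n = (\<Prod>a\<in>A. f a powi n)"
  by (induction A rule: infinite_finite_induct) (auto simp: power_int_mult_distrib)

text \<open>On a common finite support \<open>U\<close> the difference of the two multiplicity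
  functions has vanishing power sums. The multiplicities \<open>c\<close> may be negative, so the
  products are compared through integer powers.\<close>

lemma power_sums_determine_multiset:
  fixes S0 :: "complex multiset" and S :: "'i \<Rightarrow> complex multiset" and c :: "'i \<Rightarrow> int"
  assumes fin: "finite I"
    and sums: "\<And>k. (\<Sum>a\<in>#S0. a ^ k) = (\<Sum>i\<in>I. of_int (c i) * (\<Sum>a\<in>#S i. a ^ k))"
  shows "int (count S0 a) = (\<Sum>i\<in>I. c i * int (count (S i) a))"
    and "(\<Prod>a\<in>#filter_mset (\<lambda>a. a \<noteq> 0) S0. a)
      = (\<Prod>i\<in>I. (\<Prod>a\<in>#filter_mset (\<lambda>a. a \<noteq> 0) (S i). a) powi c i)"
proof -
  define U where "U = set_mset S0 \<union> (\<Union>i\<in>I. set_mset (S i))"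
  have finU: "finite U" using fin by (simp add: U_def)
  have sum_count: "(\<Sum>a\<in>#M. a ^ k) = (\<Sum>a\<in>U. of_nat (count M a) * a ^ k)" if "set_mset M \<subseteq> U" for M k
  proof -
    from that show ?thesis
    proof (induction M)
      case (add x M)
      have "(\<Sum>a\<in>U. of_nat (count (add_mset x M) a) * a ^ k)
          = (\<Sum>a\<in>U. of_nat (count M a) * a ^ k + (if a = x then a ^ k else 0))"
        by (intro sum.cong) (auto simp: algebra_simps)
      also have "\<dots> = (\<Sum>a\<in>U. of_nat (count M a) * a ^ k) + x ^ k"
        using add.prems finU by (simp add: sum.distrib)
      finally show ?case using add by simp
    qed simp
  qed
  have count: "int (count S0 a) = (\<Sum>i\<in>I. c i * int (count (S i) a))" for a
  proof (cases "a \<in> U")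
    case True
    define d where "d a = (of_nat (count S0 a) - (\<Sum>i\<in>I. of_int (c i) * of_nat (count (S i) a)) :: complex)" for a
    have "(\<Sum>a\<in>U. d a * a ^ k) = 0" for k
    proof -
      have "(\<Sum>a\<in>U. d a * a ^ k) = (\<Sum>a\<in>U. of_nat (count S0 a) * a ^ k)
          - (\<Sum>a\<in>U. \<Sum>i\<in>I. of_int (c i) * (of_nat (count (S i) a) * a ^ k))"
        by (simp add: d_def algebra_simps sum_subtractf sum_distrib_left)
      also have "(\<Sum>a\<in>U. \<Sum>i\<in>I. of_int (c i) * (of_nat (count (S i) a) * a ^ k))
          = (\<Sum>i\<in>I. of_int (c i) * (\<Sum>a\<in>U. of_nat (count (S i) a) * a ^ k))"
        by (subst sum.swap) (simp add: sum_distrib_left)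
      also have "\<dots> = (\<Sum>i\<in>I. of_int (c i) * (\<Sum>a\<in>#S i. a ^ k))"
      proof (intro sum.cong refl)
        fix i assume "i \<in> I"
        then have "set_mset (S i) \<subseteq> U" by (auto simp: U_def)
        from sum_count[OF this] show "of_int (c i) * (\<Sum>a\<in>U. of_nat (count (S i) a) * a ^ k)
            = of_int (c i) * (\<Sum>a\<in>#S i. a ^ k)" by simp
      qed
      also have "(\<Sum>a\<in>U. of_nat (count S0 a) * a ^ k) = (\<Sum>a\<in>#S0. a ^ k)"
        by (rule sum_count[symmetric]) (simp add: U_def)
      finally show ?thesis by (simp add: sums)
    qed
    from power_sums_determine_coeffs[OF finU this True] have "d a = 0" .
    then have "complex_of_int (int (count S0 a)) = of_int (\<Sum>i\<in>I. c i * int (count (S i) a))"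
      by (simp add: d_def)
    then show ?thesis by (simp only: of_int_eq_iff)
  next
    case False
    then have "count S0 a = 0" "\<And>i. i \<in> I \<Longrightarrow> count (S i) a = 0"
      by (auto simp: U_def not_in_iff)
    then show ?thesis by simp
  qed
  show "int (count S0 a) = (\<Sum>i\<in>I. c i * int (count (S i) a))" by (rule count)
  \<comment> \<open>The exponents are additive only over a nonzero base, which is why 0 is removed
    from the support here.\<close>
  have prod_count: "(\<Prod>a\<in>#filter_mset (\<lambda>a. a \<noteq> 0) M. a) = (\<Prod>a\<in>U - {0}. a powi int (count M a))"
    if "set_mset M \<subseteq> U" for M
  proof -
    have "(\<Prod>a\<in>#filter_mset (\<lambda>a. a \<noteq> 0) M. a)
        = (\<Prod>a\<in>set_mset (filter_mset (\<lambda>a. a \<noteq> 0) M). a ^ count (filter_mset (\<lambda>a. a \<noteq> 0) M) a)"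
      by (simp add: prod_mset_multiplicity)
    also have "\<dots> = (\<Prod>a\<in>U - {0}. a ^ count (filter_mset (\<lambda>a. a \<noteq> 0) M) a)"
      using that finU by (intro prod.mono_neutral_left) (auto intro!: count_inI)
    also have "\<dots> = (\<Prod>a\<in>U - {0}. a powi int (count M a))"
      by (intro prod.cong) auto
    finally show ?thesis .
  qed
  have "(\<Prod>a\<in>#filter_mset (\<lambda>a. a \<noteq> 0) S0. a) = (\<Prod>a\<in>U - {0}. a powi int (count S0 a))"
    by (rule prod_count) (simp add: U_def)
  also have "\<dots> = (\<Prod>a\<in>U - {0}. \<Prod>i\<in>I. (a powi int (count (S i) a)) powi c i)"
  proof (intro prod.cong refl)
    fix a assume "a \<in> U - {0}"
    then have "a powi int (count S0 a) = (\<Prod>i\<in>I. a powi (int (count (S i) a) * c i))"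
      by (simp add: count power_int_sum mult.commute)
    then show "a powi int (count S0 a) = (\<Prod>i\<in>I. (a powi int (count (S i) a)) powi c i)"
      by (simp only: power_int_mult)
  qed
  also have "\<dots> = (\<Prod>i\<in>I. \<Prod>a\<in>U - {0}. (a powi int (count (S i) a)) powi c i)"
    by (rule prod.swap)
  also have "\<dots> = (\<Prod>i\<in>I. (\<Prod>a\<in>#filter_mset (\<lambda>a. a \<noteq> 0) (S i). a) powi c i)"
  proof (intro prod.cong refl)
    fix i assume "i \<in> I"
    then have "set_mset (S i) \<subseteq> U" by (auto simp: U_def)
    from prod_count[OF this]
    show "(\<Prod>a\<in>U - {0}. (a powi int (count (S i) a)) powi c i)
        = (\<Prod>a\<in>#filter_mset (\<lambda>a. a \<noteq> 0) (S i). a) powi c i"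
      by (simp add: power_int_prod_distrib)
  qed
  finally show "(\<Prod>a\<in>#filter_mset (\<lambda>a. a \<noteq> 0) S0. a)
      = (\<Prod>i\<in>I. (\<Prod>a\<in>#filter_mset (\<lambda>a. a \<noteq> 0) (S i). a) powi c i)" .
qed

section \<open>The matrix tree theorem\<close>

lemma det_fun_mat:
  "det (fun_mat e n A) = (\<Sum>p\<in>{p. p permutes {0..<n}}. signof p * (\<Prod>i = 0..<n. A (e i) (e (p i))))"
  unfolding det_def'[OF fun_mat_simps(1)]
proof (intro sum.cong refl arg_cong2[where f = "(*)"] prod.cong)
  fix p i assume "p \<in> {p. p permutes {0..<n}}" "i \<in> {0..<n}"
  then have "i < n" "p i < n" using permutes_in_image[of p "{0..<n}" i] by auto
  then show "fun_mat e n A $$ (i, p i) = A (e i) (e (p i))" by simp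
qed

text \<open>In a nonzero Leibniz term the permutation sends each index that it moves along
  \<open>g\<close>, hence strictly down in \<open>d\<close>. A permutation preserves the total of
  \<open>d\<close>, so only the identity is left, and the diagonal is 1 because \<open>g\<close>
  fixes no vertex.\<close>

lemma det_step_mat_acyclic:
  fixes g :: "'v \<Rightarrow> 'v option" and d :: "'v \<Rightarrow> nat"
  assumes e: "bij_betw e {0..<n} V" and d: "\<And>v u. v \<in> V \<Longrightarrow> g v = Some u \<Longrightarrow> d u < d v"
  shows "det (fun_mat e n (\<lambda>v u. of_bool (v = u) - of_bool (g v = Some u))) = (1::'a::idom)"
proof -
  define M where "M = fun_mat e n (\<lambda>v u. of_bool (v = u) - of_bool (g v = Some u) :: 'a)"
  have eV: "e i \<in> V" if "i < n" for i
    using e that by (auto simp: bij_betw_def)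
  have e_eq: "e i = e j \<longleftrightarrow> i = j" if "i < n" "j < n" for i j
    using e that by (auto simp: bij_betw_def inj_on_eq_iff)
  have zero: "(\<Prod>i = 0..<n. M $$ (i, p i)) = 0" if p: "p permutes {0..<n}" "p \<noteq> id" for p
  proof (rule ccontr)
    assume "(\<Prod>i = 0..<n. M $$ (i, p i)) \<noteq> 0"
    then have nz: "M $$ (i, p i) \<noteq> 0" if "i < n" for i
      using that by (auto simp: prod_zero_iff)
    have pn: "p i < n" if "i < n" for i
      using permutes_in_image[OF p(1)] that by auto
    have less: "d (e (p i)) < d (e i)" if "i < n" "p i \<noteq> i" for i
    proof -
      have "g (e i) = Some (e (p i))"
        using nz[OF that(1)] that pn[OF that(1)] e_eq[of i "p i"] by (auto simp: M_def of_bool_def split: if_splits)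
      then show ?thesis using d eV that by blast
    qed
    obtain j where "p j \<noteq> j" using p by fastforce
    then have j: "j < n" using permutes_not_in[OF p(1)] by force
    have "(\<Sum>i = 0..<n. d (e (p i))) < (\<Sum>i = 0..<n. d (e i))"
    proof (rule sum_strict_mono_ex1)
      show "\<forall>i\<in>{0..<n}. d (e (p i)) \<le> d (e i)"
      proof
        fix i assume "i \<in> {0..<n}"
        then show "d (e (p i)) \<le> d (e i)" using less[of i] by (cases "p i = i") auto
      qed
      show "\<exists>i\<in>{0..<n}. d (e (p i)) < d (e i)"
        using less[OF j \<open>p j \<noteq> j\<close>] j by (intro bexI[of _ j]) auto
    qed simp
    moreover have "(\<Sum>i = 0..<n. d (e (p i))) = (\<Sum>i = 0..<n. d (e i))"
      using sum.permute[OF p(1), of "\<lambda>i. d (e i)"] by (simp add: o_def)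
    ultimately show False by simp
  qed
  have "det M = (\<Sum>p\<in>{p. p permutes {0..<n}}. signof p * (\<Prod>i = 0..<n. M $$ (i, p i)))"
    by (rule det_def') (simp add: M_def)
  also have "\<dots> = (\<Sum>p\<in>{id}. signof p * (\<Prod>i = 0..<n. M $$ (i, p i)))"
    using zero by (intro sum.mono_neutral_right) (auto simp: finite_permutations permutes_id)
  also have "\<dots> = (\<Prod>i = 0..<n. M $$ (i, i))" by simp
  also have "\<dots> = 1"
  proof (intro prod.neutral ballI)
    fix i assume "i \<in> {0..<n}"
    then show "M $$ (i, i) = 1"
      using d[OF eV, of i "e i"] by (auto simp: M_def)
  qed
  finally show ?thesis by (simp add: M_def)
qed

text \<open>
  The vertices from which the iteration of \<open>g\<close> never stops form a set whose indicator
  function is in the kernel of the matrix.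
\<close>

lemma det_step_mat_cyclic:
  fixes g :: "'v \<Rightarrow> 'v option"
  assumes e: "bij_betw e {0..<n} V" and V: "\<And>v u. v \<in> V \<Longrightarrow> g v = Some u \<Longrightarrow> u \<in> V"
    and cyc: "\<nexists>d :: 'v \<Rightarrow> nat. \<forall>v\<in>V. \<forall>u. g v = Some u \<longrightarrow> d u < d v"
  shows "det (fun_mat e n (\<lambda>v u. of_bool (v = u) - of_bool (g v = Some u))) = (0::'a::idom)"
proof -
  \<comment> \<open>\<open>it k v\<close> follows \<open>g\<close> for k steps from \<open>v\<close>
    and is \<open>None\<close> from the moment \<open>g\<close> is undefined.\<close>
  define it where "it k v = ((\<lambda>x. Option.bind x g) ^^ k) (Some v)" for k v
  define M where "M = fun_mat e n (\<lambda>v u. of_bool (v = u) - of_bool (g v = Some u) :: 'a)"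
  have it_0: "it 0 v = Some v" for v by (simp add: it_def)
  have it_Suc: "it (Suc k) v = it k u" if "g v = Some u" for k u v
    using that by (simp add: it_def funpow_Suc_right del: funpow.simps)
  have it_None: "it (Suc 0) v = None" if "g v = None" for v
    using that by (simp add: it_def)
  define B where "B = {v \<in> V. \<forall>k. it k v \<noteq> None}"
  have B_step: "v \<in> B \<longleftrightarrow> (\<exists>u. g v = Some u \<and> u \<in> B)" if "v \<in> V" for v
  proof (cases "g v")
    case None
    then show ?thesis using it_None[of v] by (auto simp: B_def)
  next
    case (Some u)
    have "(\<forall>k. it k v \<noteq> None) \<longleftrightarrow> (\<forall>k. it k u \<noteq> None)"
      using it_Suc[OF Some] it_0[of v] by (metis not0_implies_Suc option.distinct(1))
    then show ?thesis using Some V that by (auto simp: B_def)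
  qed
  \<comment> \<open>If every iteration stopped, the stopping time would be a function that decreases
    along \<open>g\<close>, contrary to \<open>cyc\<close>.\<close>
  have "B \<noteq> {}"
  proof
    assume "B = {}"
    define d where "d v = (LEAST k. it k v = None)" for v
    have "d u < d v" if "v \<in> V" "g v = Some u" for u v
    proof -
      from \<open>B = {}\<close> \<open>v \<in> V\<close> obtain k where "it k v = None" by (auto simp: B_def)
      then have "d v = Suc (LEAST k. it (Suc k) v = None)"
        unfolding d_def by (rule Least_Suc) (simp add: it_0)
      then show ?thesis using it_Suc[OF that(2)] by (simp add: d_def)
    qed
    with cyc show False by blast
  qed
  then obtain b where b: "b \<in> B" by blast
  have eV: "e i \<in> V" if "i < n" for i
    using e that by (auto simp: bij_betw_def)
  obtain i0 where i0: "i0 < n" "e i0 = b"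
    using b e by (auto simp: B_def bij_betw_def)
  have [simp]: "finite V" using e bij_betw_finite by blast
  define x where "x = vec n (\<lambda>i. of_bool (e i \<in> B) :: 'a)"
  have "M *\<^sub>v x = 0\<^sub>v n"
  proof (rule eq_vecI)
    fix i assume "i < dim_vec (0\<^sub>v n :: 'a vec)"
    then have i: "i < n" by simp
    have "(M *\<^sub>v x) $ i = (\<Sum>j = 0..<n. (of_bool (e i = e j) - of_bool (g (e i) = Some (e j))) * of_bool (e j \<in> B))"
      using i by (simp add: M_def x_def scalar_prod_def)
    also have "\<dots> = (\<Sum>u\<in>V. (of_bool (e i = u) - of_bool (g (e i) = Some u)) * of_bool (u \<in> B))"
      by (rule sum.reindex_bij_betw[OF e])
    also have "\<dots> = (\<Sum>u\<in>V. if e i = u then of_bool (u \<in> B) else 0) - (\<Sum>u\<in>V. if g (e i) = Some u then of_bool (u \<in> B) else 0)"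
      unfolding sum_subtractf[symmetric] by (intro sum.cong) auto
    also have "(\<Sum>u\<in>V. if e i = u then of_bool (u \<in> B) else 0) = (of_bool (e i \<in> B) :: 'a)"
      using eV[OF i] by simp
    also have "(\<Sum>u\<in>V. if g (e i) = Some u then of_bool (u \<in> B) else 0) = (of_bool (e i \<in> B) :: 'a)"
    proof (cases "g (e i)")
      case None
      then show ?thesis using B_step[OF eV[OF i]] by simp
    next
      case (Some u)
      then show ?thesis using B_step[OF eV[OF i]] V[OF eV[OF i] Some] by simp
    qed
    finally show "(M *\<^sub>v x) $ i = 0\<^sub>v n $ i" using i by simp
  qed (simp add: M_def)
  moreover have "x \<noteq> 0\<^sub>v n"
  proof
    assume "x = 0\<^sub>v n"
    then have "x $ i0 = 0" using i0 by simp
    then show False using i0 b by (simp add: x_def)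
  qed
  ultimately have "det M = 0"
    using det_0_iff_vec_prod_zero[of M n] fun_mat_simps(1) vec_carrier unfolding M_def x_def by blast
  then show ?thesis by (simp add: M_def)
qed

text \<open>Multilinearity in the rows: row v is a sum over \<open>C v\<close>, and a choice of one
  summand per row is a function in \<open>PiE V C\<close>. The expansion takes place inside each
  Leibniz term, as a product of sums.\<close>

lemma det_fun_mat_expand:
  fixes w :: "'v \<Rightarrow> 'c \<Rightarrow> 'a::comm_ring_1"
  assumes e: "bij_betw e {0..<n} V" and C: "\<And>v. v \<in> V \<Longrightarrow> finite (C v)"
  shows "det (fun_mat e n (\<lambda>v u. \<Sum>c\<in>C v. w v c * R c v u))
    = (\<Sum>f\<in>PiE V C. (\<Prod>v\<in>V. w v (f v)) * det (fun_mat e n (\<lambda>v u. R (f v) v u)))"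
proof -
  have [simp]: "finite V" using e bij_betw_finite by blast
  have row: "(\<Prod>i = 0..<n. \<Sum>c\<in>C (e i). w (e i) c * R c (e i) (e (p i)))
      = (\<Sum>f\<in>PiE V C. (\<Prod>v\<in>V. w v (f v)) * (\<Prod>i = 0..<n. R (f (e i)) (e i) (e (p i))))" for p
  proof -
    \<comment> \<open>\<open>h\<close> recovers the index of a vertex, which allows products over
      indices that involve p to be written as products over \<open>V\<close>.\<close>
    define h where "h = inv_into {0..<n} e"
    have h: "h (e i) = i" if "i < n" for i
      using e that by (simp add: h_def bij_betw_inv_into_left)
    have re: "(\<Prod>i = 0..<n. F (e i) (e (p i))) = (\<Prod>v\<in>V. F v (e (p (h v))))" for F :: "'v \<Rightarrow> 'v \<Rightarrow> 'a"
      unfolding prod.reindex_bij_betw[OF e, symmetric] by (intro prod.cong) (auto simp: h)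
    show ?thesis
      unfolding re[of "\<lambda>v u. \<Sum>c\<in>C v. w v c * R c v u"]
      using C by (subst prod_sum_PiE) (auto simp: prod.distrib re[of "\<lambda>v u. R (_ v) v u"])
  qed
  have "det (fun_mat e n (\<lambda>v u. \<Sum>c\<in>C v. w v c * R c v u))
      = (\<Sum>p\<in>{p. p permutes {0..<n}}. signof p * (\<Prod>i = 0..<n. \<Sum>c\<in>C (e i). w (e i) c * R c (e i) (e (p i))))"
    by (simp add: det_fun_mat)
  also have "\<dots> = (\<Sum>p\<in>{p. p permutes {0..<n}}. \<Sum>f\<in>PiE V C. (\<Prod>v\<in>V. w v (f v)) *
      (signof p * (\<Prod>i = 0..<n. R (f (e i)) (e i) (e (p i)))))"
    unfolding row by (simp add: sum_distrib_left mult.left_commute)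
  also have "\<dots> = (\<Sum>f\<in>PiE V C. (\<Prod>v\<in>V. w v (f v)) *
      (\<Sum>p\<in>{p. p permutes {0..<n}}. signof p * (\<Prod>i = 0..<n. R (f (e i)) (e i) (e (p i)))))"
    by (subst sum.swap) (simp add: sum_distrib_left)
  also have "\<dots> = (\<Sum>f\<in>PiE V C. (\<Prod>v\<in>V. w v (f v)) * det (fun_mat e n (\<lambda>v u. R (f v) v u)))"
    by (simp add: det_fun_mat)
  finally show ?thesis .
qed

section \<open>Closed walks and reversed arcs\<close>

context pre_digraph begin

text \<open>Every arc of a closed walk has a cyclic predecessor and successor: within the list its
  neighbours, at the ends the last and the first arc, which meet in u.\<close>

lemma closed_cas_arcs:
  assumes "cas u p u" and "a \<in> set p"
  shows "\<exists>b\<in>set p. head G b = tail G a" and "\<exists>b\<in>set p. tail G b = head G a"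
proof -
  have fwd: "cas u p v \<Longrightarrow> a \<in> set p \<Longrightarrow> head G a = v \<or> (\<exists>b\<in>set p. tail G b = head G a)" for u p v
  proof (induction p arbitrary: u)
    case (Cons c p)
    then show ?case by (cases p) auto
  qed simp
  have bwd: "cas u p v \<Longrightarrow> a \<in> set p \<Longrightarrow> tail G a = u \<or> (\<exists>b\<in>set p. head G b = tail G a)" for u p v
  proof (induction p arbitrary: u)
    case (Cons c p)
    then show ?case by auto
  qed simp
  have first: "cas u p v \<Longrightarrow> p \<noteq> [] \<Longrightarrow> tail G (hd p) = u" for u p v
    by (cases p) auto
  have last: "cas u p v \<Longrightarrow> p \<noteq> [] \<Longrightarrow> head G (last p) = v" for u p v
    by (induction p arbitrary: u) auto
  have "p \<noteq> []" using assms by auto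
  show "\<exists>b\<in>set p. head G b = tail G a"
    using bwd[OF assms] last[OF assms(1) \<open>p \<noteq> []\<close>] \<open>p \<noteq> []\<close> last_in_set by metis
  show "\<exists>b\<in>set p. tail G b = head G a"
    using fwd[OF assms] first[OF assms(1) \<open>p \<noteq> []\<close>] \<open>p \<noteq> []\<close> list.set_sel(1) by metis
qed

end

text \<open>The reverse of the first arc would end in the start vertex, which a simple path never
  enters again; the rest is induction.\<close>

lemma (in bidirected_digraph) no_reversed_arcs_in_apath:
  assumes "cas u p v" "set p \<subseteq> arcs G" "distinct (awalk_verts u p)" "a \<in> set p"
  shows "arev a \<notin> set p"
  using assms
proof (induction p arbitrary: u)
  case (Cons c p)
  have c: "tail G c = u" "c \<in> arcs G" and p: "cas (head G c) p v"
    using Cons.prems by auto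
  have u: "u \<notin> set (awalk_verts (head G c) p)"
    using Cons.prems by auto
  have heads: "head G b \<noteq> u" if "b \<in> set p" for b
    using u that by (auto simp: set_awalk_verts_cas[OF p])
  have "arev c \<notin> set p" using heads[of "arev c"] c by auto
  moreover have "arev b \<noteq> c" if "b \<in> set p" for b
    using \<open>arev c \<notin> set p\<close> that by auto
  moreover have "arev c \<noteq> c" using c arev_neq by blast
  moreover have "arev a \<notin> set p" if "a \<in> set p"
    using Cons.IH[OF p] Cons.prems that by auto
  ultimately show ?case using Cons.prems(4) by auto
qed simp

section \<open>Spanning trees as acyclic choices of arcs\<close>

context finite_connected_graph begin

text \<open>\<open>None\<close> marks a root. The choices at v match the summands of row v of t + L:
  \<open>None\<close> stands for the shift t, \<open>Some a\<close> for the contribution of the arc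
  a.\<close>

definition arc_choices :: "'v \<Rightarrow> 'e option set" where
  "arc_choices v = insert None (Some ` out_arcs X v)"

text \<open>A height that falls along the chosen arcs expresses that following them never runs in a
  circle. The same height drives the inductions below.\<close>

definition acyclic_choice :: "('v \<Rightarrow> 'e option) \<Rightarrow> bool" where
  "acyclic_choice f \<longleftrightarrow>
     (\<exists>d :: 'v \<Rightarrow> nat. \<forall>v\<in>verts X. \<forall>a. f v = Some a \<longrightarrow> d (head X a) < d v)"

text \<open>These are the spanning trees with all edges oriented towards r.\<close>

definition rooted_choices :: "'v \<Rightarrow> ('v \<Rightarrow> 'e option) set" where
  "rooted_choices r = {f \<in> PiE (verts X) arc_choices. acyclic_choice f \<and> {v \<in> verts X. f v = None} = {r}}"

text \<open>Forgets the orientation by keeping both arcs of every chosen edge.\<close>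

definition choice_tree :: "('v \<Rightarrow> 'e option) \<Rightarrow> ('v, 'e) pre_digraph" where
  "choice_tree f =
     \<lparr>verts = verts X, arcs = {a. \<exists>v\<in>verts X. f v = Some a \<or> f v = Some (arev a)},
      tail = tail X, head = head X\<rparr>"

lemma choice_tree_simps [simp]:
  "verts (choice_tree f) = verts X" "tail (choice_tree f) = tail X" "head (choice_tree f) = head X"
  "a \<in> arcs (choice_tree f) \<longleftrightarrow> (\<exists>v\<in>verts X. f v = Some a \<or> f v = Some (arev a))"
  by (auto simp: choice_tree_def)

lemma choiceD:
  assumes "f \<in> PiE (verts X) arc_choices" "v \<in> verts X" "f v = Some a"
  shows "a \<in> arcs X" "tail X a = v"
proof -
  have "f v \<in> arc_choices v" using assms(1,2) by (rule PiE_mem)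
  with assms(3) show "a \<in> arcs X" "tail X a = v" by (auto simp: arc_choices_def)
qed

lemma arcs_choice_treeE:
  assumes "f \<in> PiE (verts X) arc_choices" "a \<in> arcs (choice_tree f)"
  shows "a \<in> arcs X" and "f (tail X a) = Some a \<or> f (head X a) = Some (arev a)"
proof -
  obtain v where v: "v \<in> verts X" "f v = Some a \<or> f v = Some (arev a)"
    using assms(2) by auto
  show "a \<in> arcs X"
    using v(2) choiceD(1)[OF assms(1) v(1)] arev_in_arcs[of "arev a"] by auto
  then show "f (tail X a) = Some a \<or> f (head X a) = Some (arev a)"
    using v(2) choiceD(2)[OF assms(1) v(1)] by auto
qed

lemma bidirected_subgraph:
  assumes "spanning T X" "arev ` arcs T \<subseteq> arcs T"
  shows "wf_digraph T" "verts T = verts X" "arcs T \<subseteq> arcs X" "tail T = tail X" "head T = head X"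
    "symmetric T"
proof -
  show T: "wf_digraph T" "verts T = verts X" "arcs T \<subseteq> arcs X" "tail T = tail X" "head T = head X"
    using assms(1) by (auto simp: spanning_def subgraph_def compatible_def)
  show "symmetric T"
    unfolding symmetric_def sym_def arcs_ends_conv
  proof safe
    fix a assume a: "a \<in> arcs T"
    then have "arev a \<in> arcs T" "a \<in> arcs X" using assms(2) T(3) by auto
    then show "(head T a, tail T a) \<in> (\<lambda>e. (tail T e, head T e)) ` arcs T"
      by (intro image_eqI[of _ _ "arev a"]) (auto simp: T)
  qed
qed

lemma choice_tree_spanning:
  assumes "f \<in> PiE (verts X) arc_choices"
  shows "spanning (choice_tree f) X" "arev ` arcs (choice_tree f) \<subseteq> arcs (choice_tree f)"
proof -
  have sub: "a \<in> arcs X" if "a \<in> arcs (choice_tree f)" for a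
    using arcs_choice_treeE(1)[OF assms that] .
  then have "wf_digraph (choice_tree f)"
    by unfold_locales (simp_all del: choice_tree_simps(4))
  then show "spanning (choice_tree f) X"
    using sub wf_digraph by (auto simp: spanning_def subgraph_def compatible_def simp del: choice_tree_simps(4))
  show "arev ` arcs (choice_tree f) \<subseteq> arcs (choice_tree f)"
    by auto
qed

text \<open>Closure under the involution makes \<open>T\<close> symmetric, so any two vertices are
  joined through r.\<close>

lemma connected_if_reaches:
  assumes "spanning T X" "arev ` arcs T \<subseteq> arcs T"
    and "\<And>v. v \<in> verts X \<Longrightarrow> v \<rightarrow>\<^sup>*\<^bsub>T\<^esub> r"
  shows "Digraph_Component.connected T"
proof -
  note T = bidirected_subgraph[OF assms(1,2)]
  interpret T: wf_digraph T by (rule T(1))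
  show ?thesis
  proof (rule T.connectedI)
    show "verts T \<noteq> {}" using T(2) connected by (auto simp: connected_conv)
    fix u v assume "u \<in> verts T" "v \<in> verts T"
    then have "u \<rightarrow>\<^sup>*\<^bsub>T\<^esub> r" "v \<rightarrow>\<^sup>*\<^bsub>T\<^esub> r" using assms(3) T(2) by auto
    then have "u \<rightarrow>\<^sup>*\<^bsub>T\<^esub> v"
      using symmetric_reachable[OF T(6)] T.reachable_trans by blast
    then show "u \<rightarrow>\<^sup>*\<^bsub>mk_symmetric T\<^esub> v" by (rule T.reachable_mk_symmetricI)
  qed
qed

lemma choice_tree_reaches_root:
  assumes f: "f \<in> rooted_choices r" and v: "v \<in> verts X"
  shows "v \<rightarrow>\<^sup>*\<^bsub>choice_tree f\<^esub> r"
proof -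
  have root: "f v = None \<longleftrightarrow> v = r" if "v \<in> verts X" for v
    using f that by (auto simp: rooted_choices_def)
  obtain d where d: "\<And>v a. v \<in> verts X \<Longrightarrow> f v = Some a \<Longrightarrow> d (head X a) < (d v :: nat)"
    using f unfolding rooted_choices_def acyclic_choice_def by blast
  have fP: "f \<in> PiE (verts X) arc_choices" using f by (auto simp: rooted_choices_def)
  interpret T: wf_digraph "choice_tree f"
    using bidirected_subgraph choice_tree_spanning[OF fP] by blast
  show ?thesis using v
  proof (induction "d v" arbitrary: v rule: less_induct)
    case less
    show ?case
    proof (cases "f v")
      case None
      then show ?thesis using root less.prems by auto
    next
      case (Some a)
      note a = choiceD[OF fP less.prems Some]
      have "a \<in> arcs (choice_tree f)" using Some less.prems by auto
      then have "v \<rightarrow>\<^bsub>choice_tree f\<^esub> head X a"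
        using a by (auto simp: arcs_ends_conv simp del: choice_tree_simps(4))
      moreover have "head X a \<rightarrow>\<^sup>*\<^bsub>choice_tree f\<^esub> r"
        using less.hyps d[OF less.prems Some] a by auto
      ultimately show ?thesis by (rule T.adj_reachable_trans)
    qed
  qed
qed

lemma choice_tree_connected:
  assumes f: "f \<in> rooted_choices r"
  shows "Digraph_Component.connected (choice_tree f)"
  using f connected_if_reaches choice_tree_spanning choice_tree_reaches_root
  unfolding rooted_choices_def by blast

text \<open>Each edge of the tree is chosen at its higher end. In a cycle let b be an arc whose tail
  has maximal height and let a be the arc before it. Then b and the reverse of a are both the choice
  at this vertex, hence equal, and the cycle uses both orientations of an edge.\<close>

lemma choice_tree_in_spanning_trees:
  assumes f: "f \<in> rooted_choices r"
  shows "choice_tree f \<in> spanning_trees X arev"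
proof -
  have fP: "f \<in> PiE (verts X) arc_choices" using f by (auto simp: rooted_choices_def)
  obtain d where d: "\<And>v a. v \<in> verts X \<Longrightarrow> f v = Some a \<Longrightarrow> d (head X a) < (d v :: nat)"
    using f unfolding rooted_choices_def acyclic_choice_def by blast
  have "undirected_acyclic (choice_tree f) arev"
    unfolding undirected_acyclic_def
  proof safe
    fix p assume cyc: "pre_digraph.cycle (choice_tree f) p" and norev: "\<forall>a\<in>set p. arev a \<notin> set p"
    then obtain u where "pre_digraph.awalk (choice_tree f) u p u" and "p \<noteq> []"
      by (auto simp: pre_digraph.cycle_def)
    then have sub: "set p \<subseteq> arcs (choice_tree f)" and cas: "cas u p u"
      using compatible_cas[of "choice_tree f" X] by (auto simp: pre_digraph.awalk_def compatible_def)
    have "Max ((\<lambda>a. d (tail X a)) ` set p) \<in> (\<lambda>a. d (tail X a)) ` set p"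
      using \<open>p \<noteq> []\<close> by (intro Max_in) auto
    then obtain b where b: "b \<in> set p" "Max ((\<lambda>a. d (tail X a)) ` set p) = d (tail X b)"
      by blast
    then have max: "d (tail X a) \<le> d (tail X b)" if "a \<in> set p" for a
      using that by (metis List.finite_set Max_ge finite_imageI imageI)
    obtain a where a: "a \<in> set p" "head X a = tail X b"
      using closed_cas_arcs(1)[OF cas b(1)] by auto
    \<comment> \<open>The maximum runs over tails only; the arc after \<open>b\<close> shows that
      the head of \<open>b\<close> is also a tail in the cycle.\<close>
    obtain c where c: "c \<in> set p" "tail X c = head X b"
      using closed_cas_arcs(2)[OF cas b(1)] by auto
    have aX: "a \<in> arcs X" "b \<in> arcs X" "arev b \<in> arcs X"
      using arcs_choice_treeE(1)[OF fP] sub a b by (auto simp del: choice_tree_simps(4))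
    have "f (head X a) = Some (arev a)"
    proof (rule ccontr)
      assume "f (head X a) \<noteq> Some (arev a)"
      then have "f (tail X a) = Some a"
        using arcs_choice_treeE(2)[OF fP] sub a(1) by blast
      then have "d (tail X b) < d (tail X a)" using d[of "tail X a" a] aX a(2) by auto
      with max[OF a(1)] show False by simp
    qed
    moreover have "f (tail X b) = Some b"
    proof (rule ccontr)
      assume "f (tail X b) \<noteq> Some b"
      then have "f (head X b) = Some (arev b)"
        using arcs_choice_treeE(2)[OF fP] sub b by blast
      then have "d (tail X b) < d (head X b)" using d[of "head X b" "arev b"] aX by auto
      with max[OF c(1)] c(2) show False by simp
    qed
    ultimately have "arev a = b" using a(2) by simp
    then show False using norev a b by auto
  qed
  then show ?thesis
    using choice_tree_spanning[OF fP] choice_tree_connected[OF f] by (auto simp: spanning_trees_def)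
qed

text \<open>Every vertex other than r chooses the first arc of a shortest walk to r inside
  \<open>T\<close>; the distance \<open>d\<close> to r serves as the height.\<close>

lemma exists_rooted_choice:
  assumes T: "spanning T X" "arev ` arcs T \<subseteq> arcs T" "Digraph_Component.connected T" and r: "r \<in> verts X"
  obtains f where "f \<in> rooted_choices r" "arcs (choice_tree f) \<subseteq> arcs T"
proof -
  note TX = bidirected_subgraph[OF T(1,2)]
  interpret T: wf_digraph T by (rule TX(1))
  define d where "d v = (LEAST k. \<exists>p. T.awalk v p r \<and> length p = k)" for v
  have step: "\<exists>a\<in>arcs T. tail X a = v \<and> d (head X a) < d v" if v: "v \<in> verts X" "v \<noteq> r" for v
  proof -
    have "v \<rightarrow>\<^sup>*\<^bsub>T\<^esub> r"
      using T.symmetric_connected_imp_strongly_connected[OF TX(6) T(3)] v r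
      by (auto simp: strongly_connected_def TX(2))
    then have "\<exists>k p. T.awalk v p r \<and> length p = k" by (auto simp: T.reachable_awalk)
    then have "\<exists>p. T.awalk v p r \<and> length p = d v"
      unfolding d_def by (rule LeastI_ex)
    then obtain p where p: "T.awalk v p r" "length p = d v" by blast
    then obtain a q where q: "p = a # q" using v(2) by (cases p) (auto simp: T.awalk_def)
    then have a: "a \<in> arcs T" "tail X a = v" "T.awalk (head X a) q r"
      using p(1) by (auto simp: T.awalk_Cons_iff TX)
    have "d (head X a) \<le> length q"
      unfolding d_def by (rule Least_le) (use a in auto)
    then show ?thesis using a p(2) q by auto
  qed
  define g where "g v = (SOME a. a \<in> arcs T \<and> tail X a = v \<and> d (head X a) < d v)" for v
  have g: "g v \<in> arcs T" "tail X (g v) = v" "d (head X (g v)) < d v" if "v \<in> verts X" "v \<noteq> r" for v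
    using someI_ex[of "\<lambda>a. a \<in> arcs T \<and> tail X a = v \<and> d (head X a) < d v"] step[OF that]
    by (auto simp: g_def)
  define f where "f = (\<lambda>v\<in>verts X. if v = r then None else Some (g v))"
  have "f \<in> rooted_choices r"
    unfolding rooted_choices_def acyclic_choice_def
  proof (intro CollectI conjI exI[of _ d])
    show "f \<in> PiE (verts X) arc_choices"
      using g subsetD[OF TX(3)] by (auto simp: f_def arc_choices_def intro!: imageI)
    show "\<forall>v\<in>verts X. \<forall>a. f v = Some a \<longrightarrow> d (head X a) < d v"
      using g by (auto simp: f_def)
    show "{v \<in> verts X. f v = None} = {r}"
      using r by (auto simp: f_def)
  qed
  moreover have "arcs (choice_tree f) \<subseteq> arcs T"
  proof
    fix a assume "a \<in> arcs (choice_tree f)"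
    then obtain v where v: "v \<in> verts X" "f v = Some a \<or> f v = Some (arev a)" by auto
    then obtain b where b: "f v = Some b" "b = a \<or> b = arev a" by auto
    then have "b = g v" "v \<noteq> r" using v(1) by (auto simp: f_def split: if_splits)
    then have "b \<in> arcs T" using g(1) v(1) by simp
    with b(2) show "a \<in> arcs T" using T(2) by (metis arev_arev image_subset_iff)
  qed
  ultimately show thesis by (rule that)
qed

text \<open>Inside \<open>T\<close> there is the tree of some rooted choice. An arc of
  \<open>T\<close> outside it, followed by a simple path back within this tree, would be a cycle of
  \<open>T\<close> that never uses both orientations of an edge.\<close>

lemma choice_tree_surj:
  assumes T: "T \<in> spanning_trees X arev" and r: "r \<in> verts X"
  shows "T \<in> choice_tree ` rooted_choices r"
proof -
  have T': "spanning T X" "arev ` arcs T \<subseteq> arcs T" "Digraph_Component.connected T" "undirected_acyclic T arev"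
    using T by (auto simp: spanning_trees_def)
  note TX = bidirected_subgraph[OF T'(1,2)]
  obtain f where f: "f \<in> rooted_choices r" "arcs (choice_tree f) \<subseteq> arcs T"
    using exists_rooted_choice[OF T'(1-3) r] by blast
  then have fP: "f \<in> PiE (verts X) arc_choices" by (auto simp: rooted_choices_def)
  interpret F: wf_digraph "choice_tree f"
    using bidirected_subgraph choice_tree_spanning[OF fP] by blast
  have "arcs T \<subseteq> arcs (choice_tree f)"
  proof
    fix a assume a: "a \<in> arcs T"
    show "a \<in> arcs (choice_tree f)"
    proof (rule ccontr)
      assume na: "a \<notin> arcs (choice_tree f)"
      have aX: "a \<in> arcs X" using a TX(3) by auto
      have revF: "arev b \<in> arcs (choice_tree f) \<longleftrightarrow> b \<in> arcs (choice_tree f)" for b by auto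
      have "head X a \<rightarrow>\<^sup>*\<^bsub>choice_tree f\<^esub> tail X a"
        using F.symmetric_connected_imp_strongly_connected[OF _ choice_tree_connected[OF f(1)]]
          bidirected_subgraph(6)[OF choice_tree_spanning[OF fP]] aX
        by (auto simp: strongly_connected_def)
      then obtain p where "F.apath (head X a) p (tail X a)"
        by (auto simp: F.reachable_apath)
      then have p: "set p \<subseteq> arcs (choice_tree f)" "cas (head X a) p (tail X a)"
        "distinct (awalk_verts (head X a) p)"
        using compatible_cas[of "choice_tree f" X] compatible_awalk_verts[of "choice_tree f" X]
        by (auto simp: F.apath_def F.awalk_def compatible_def simp del: choice_tree_simps(4))
      have pX: "set p \<subseteq> arcs X" using p(1) arcs_choice_treeE(1)[OF fP] by blast
      have "pre_digraph.cycle T (a # p)"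
        unfolding pre_digraph.cycle_def
      proof (intro exI conjI)
        show "pre_digraph.awalk T (tail X a) (a # p) (tail X a)"
          using a aX p f(2) compatible_cas[of T X]
          by (auto simp: pre_digraph.awalk_def TX compatible_def pre_digraph.cas.simps
            simp del: choice_tree_simps(4))
        show "distinct (tl (pre_digraph.awalk_verts T (tail X a) (a # p)))"
          using p(3) compatible_awalk_verts[of T X]
          by (auto simp: TX compatible_def pre_digraph.awalk_verts.simps)
      qed simp
      \<comment> \<open>A simple path contains no reversed pair, and since the tree is closed under
        reversal it contains the reverse of \<open>a\<close> no more than \<open>a\<close>.\<close>
      moreover have "arev c \<notin> set (a # p)" if "c \<in> set (a # p)" for c
      proof (cases "c = a")
        case True
        then show ?thesis using p(1) na revF[of a] arev_neq[OF aX] by (auto simp del: choice_tree_simps(4))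
      next
        case False
        then have c: "c \<in> set p" using that by simp
        then have "c \<in> arcs (choice_tree f)" using p(1) by blast
        then have "arev c \<noteq> a" using na revF[of c] by metis
        then show ?thesis using no_reversed_arcs_in_apath[OF p(2) pX p(3) c] by simp
      qed
      ultimately show False using T'(4) unfolding undirected_acyclic_def by blast
    qed
  qed
  with f(2) have "T = choice_tree f" using TX by (intro pre_digraph.equality) (auto simp del: choice_tree_simps(4))
  then show ?thesis using f(1) by blast
qed

text \<open>Induction on the height for f. The arc a chosen by f at v lies in the common tree, so g
  chooses it at v or its reverse at the head. In the second case f does so too by induction, and the
  height would fall in both directions along the edge.\<close>

lemma choice_tree_inj: "inj_on choice_tree (rooted_choices r)"
proof (rule inj_onI)
  fix f g assume f: "f \<in> rooted_choices r" and g: "g \<in> rooted_choices r" and eq: "choice_tree f = choice_tree g"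
  have fP: "f \<in> PiE (verts X) arc_choices" and gP: "g \<in> PiE (verts X) arc_choices"
    using f g by (auto simp: rooted_choices_def)
  have froot: "f v = None \<longleftrightarrow> v = r" and groot: "g v = None \<longleftrightarrow> v = r" if "v \<in> verts X" for v
    using f g that by (auto simp: rooted_choices_def)
  obtain d where d: "\<And>v a. v \<in> verts X \<Longrightarrow> f v = Some a \<Longrightarrow> d (head X a) < (d v :: nat)"
    using f unfolding rooted_choices_def acyclic_choice_def by blast
  have "f v = g v" if "v \<in> verts X" for v
    using that
  proof (induction "d v" arbitrary: v rule: less_induct)
    case less
    show ?case
    proof (cases "f v")
      case None
      then show ?thesis using froot groot less.prems by metis
    next
      case (Some a)
      note a = choiceD[OF fP less.prems Some]
      have lt: "d (head X a) < d v" by (rule d[OF less.prems Some])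
      have "a \<in> arcs (choice_tree f)" using Some less.prems by auto
      then have "g (tail X a) = Some a \<or> g (head X a) = Some (arev a)"
        using arcs_choice_treeE(2)[OF gP] eq by auto
      moreover have "g (head X a) \<noteq> Some (arev a)"
      proof
        assume "g (head X a) = Some (arev a)"
        then have "f (head X a) = Some (arev a)" using less.hyps[OF lt] a by auto
        then have "d (head X (arev a)) < d (head X a)" using d[of "head X a" "arev a"] a by auto
        with lt show False using a by simp
      qed
      ultimately show ?thesis using Some a by simp
    qed
  qed
  then show "f = g" using fP gP by (intro PiE_ext)
qed

lemma card_rooted_choices:
  assumes "r \<in> verts X"
  shows "card (rooted_choices r) = kappa X arev"
proof -
  have "choice_tree ` rooted_choices r = spanning_trees X arev"
    using choice_tree_surj[OF _ assms] choice_tree_in_spanning_trees by blast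
  then show ?thesis unfolding kappa_def using card_image[OF choice_tree_inj, of r] by simp
qed

lemma verts_nonempty: "verts X \<noteq> {}"
  using connected by (auto simp: connected_conv)

lemma finite_choices: "finite (PiE (verts X) arc_choices)"
  by (intro finite_PiE) (auto simp: arc_choices_def)

text \<open>A connected graph is a connected spanning subgraph of itself and so admits a rooted
  choice. Positivity makes the linear coefficient of the shifted determinant nonzero.\<close>

lemma kappa_pos: "0 < kappa X arev"
proof -
  obtain r where r: "r \<in> verts X" using verts_nonempty by blast
  have "spanning X X" using subgraph_refl by (simp add: spanning_def)
  moreover have "arev ` arcs X \<subseteq> arcs X" by auto
  ultimately obtain f where "f \<in> rooted_choices r"
    using exists_rooted_choice connected r by blast
  moreover have "finite (rooted_choices r)"
    using finite_choices unfolding rooted_choices_def by simp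
  ultimately show ?thesis using card_rooted_choices[OF r] card_gt_0_iff by (metis empty_iff)
qed

section \<open>The weighted matrix tree theorem\<close>

text \<open>Degree matrix minus adjacency matrix with row v multiplied by m v. The two terms of a
  loop cancel.\<close>

definition weighted_laplacian :: "('v \<Rightarrow> complex) \<Rightarrow> 'v \<Rightarrow> 'v \<Rightarrow> complex" where
  "weighted_laplacian m v u = m v * (\<Sum>a\<in>out_arcs X v. of_bool (v = u) - of_bool (head X a = u))"

text \<open>Expanding each row over the choices at its vertex leaves determinants of partial maps,
  which are 1 for acyclic choices and 0 for all others. The result is a weighted count of rooted
  forests.\<close>

lemma det_shifted_laplacian:
  assumes e: "bij_betw e {0..<n} (verts X)"
  shows "det (fun_mat e n (\<lambda>v u. (if v = u then t else 0) + weighted_laplacian m v u))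
    = (\<Sum>f | f \<in> PiE (verts X) arc_choices \<and> acyclic_choice f.
        \<Prod>v\<in>verts X. if f v = None then t else m v)"
proof -
  define w where "w v c = (if c = None then t else m v)" for v and c :: "'e option"
  define R where "R c v u = (of_bool (v = u) - of_bool (map_option (head X) c = Some u) :: complex)"
    for c v u
  have "(if v = u then t else 0) + weighted_laplacian m v u = (\<Sum>c\<in>arc_choices v. w v c * R c v u)" for v u
  proof -
    have "(\<Sum>c\<in>arc_choices v. w v c * R c v u)
        = w v None * R None v u + (\<Sum>c\<in>Some ` out_arcs X v. w v c * R c v u)"
      unfolding arc_choices_def by (subst sum.insert) auto
    also have "(\<Sum>c\<in>Some ` out_arcs X v. w v c * R c v u) = weighted_laplacian m v u"
      by (subst sum.reindex) (auto simp: w_def R_def weighted_laplacian_def sum_distrib_left)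
    finally show ?thesis by (simp add: w_def R_def)
  qed
  then have "det (fun_mat e n (\<lambda>v u. (if v = u then t else 0) + weighted_laplacian m v u))
      = det (fun_mat e n (\<lambda>v u. \<Sum>c\<in>arc_choices v. w v c * R c v u))"
    by presburger
  also have "\<dots> = (\<Sum>f\<in>PiE (verts X) arc_choices. (\<Prod>v\<in>verts X. w v (f v)) * det (fun_mat e n (\<lambda>v u. R (f v) v u)))"
    by (intro det_fun_mat_expand e) (simp add: arc_choices_def finite_out_arcs)
  also have "\<dots> = (\<Sum>f\<in>PiE (verts X) arc_choices. if acyclic_choice f then \<Prod>v\<in>verts X. w v (f v) else 0)"
  proof (intro sum.cong refl)
    fix f assume f: "f \<in> PiE (verts X) arc_choices"
    define g where "g v = map_option (head X) (f v)" for v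
    have acy: "acyclic_choice f \<longleftrightarrow> (\<exists>d :: 'v \<Rightarrow> nat. \<forall>v\<in>verts X. \<forall>u. g v = Some u \<longrightarrow> d u < d v)"
      unfolding acyclic_choice_def g_def by (auto simp: map_option_eq_Some)
    have "det (fun_mat e n (\<lambda>v u. R (f v) v u)) = of_bool (acyclic_choice f)"
    proof (cases "acyclic_choice f")
      case True
      then show ?thesis
        using acy det_step_mat_acyclic[OF e, of g] unfolding R_def g_def by auto
    next
      case False
      have V: "u \<in> verts X" if "v \<in> verts X" "g v = Some u" for v u
        using that choiceD[OF f] by (auto simp: g_def)
      have "det (fun_mat e n (\<lambda>v u. of_bool (v = u) - of_bool (g v = Some u))) = (0::complex)"
        by (rule det_step_mat_cyclic[OF e V]) (use False acy in simp_all)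
      then show ?thesis by (simp only: R_def g_def False of_bool_eq)
    qed
    then show "(\<Prod>v\<in>verts X. w v (f v)) * det (fun_mat e n (\<lambda>v u. R (f v) v u))
        = (if acyclic_choice f then \<Prod>v\<in>verts X. w v (f v) else 0)"
      by simp
  qed
  also have "\<dots> = (\<Sum>f | f \<in> PiE (verts X) arc_choices \<and> acyclic_choice f. \<Prod>v\<in>verts X. w v (f v))"
    using finite_choices by (simp add: sum.inter_filter)
  finally show ?thesis by (simp add: w_def)
qed

text \<open>A vertex of least height has no lower vertex to point to.\<close>

lemma acyclic_choice_has_root:
  assumes f: "f \<in> PiE (verts X) arc_choices" "acyclic_choice f"
  shows "{v \<in> verts X. f v = None} \<noteq> {}"
proof
  assume empty: "{v \<in> verts X. f v = None} = {}"
  obtain d where d: "\<And>v a. v \<in> verts X \<Longrightarrow> f v = Some a \<Longrightarrow> d (head X a) < (d v :: nat)"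
    using f unfolding acyclic_choice_def by blast
  obtain v where v: "v \<in> verts X" and min: "\<And>u. u \<in> verts X \<Longrightarrow> d v \<le> d u"
    using verts_nonempty finite_verts ex_min_if_finite[of "d ` verts X"]
    by (metis (mono_tags, lifting) arg_min_if_finite(1) arg_min_least)
  obtain a where a: "f v = Some a" using empty v by auto
  have "head X a \<in> verts X" using choiceD[OF f(1) v a] by auto
  from min[OF this] d[OF v a] show False by simp
qed

text \<open>The exponent of t is the number of roots of a forest. No forest is without roots, and
  those with the single root r are the spanning trees, each weighted by the product of m over the
  other vertices. Hence the coefficient of t is c.\<close>

lemma weighted_laplacian_spectrum:
  assumes m: "\<And>v. v \<in> verts X \<Longrightarrow> m v \<noteq> 0"
    and c: "c = of_nat (kappa X arev) * (\<Sum>r\<in>verts X. \<Prod>v\<in>verts X - {r}. m v)" "c \<noteq> 0"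
  shows "\<exists>S :: complex multiset.
    (\<forall>k. (\<Sum>v\<in>verts X. kernel_pow (verts X) (weighted_laplacian m) k v v) = (\<Sum>a\<in>#S. a ^ k)) \<and>
    count S 0 = 1 \<and> (\<Prod>a\<in>#filter_mset (\<lambda>a. a \<noteq> 0) S. a) = c"
proof -
  let ?V = "verts X"
  obtain e where e: "bij_betw e {0..<card ?V} ?V"
    using ex_bij_betw_nat_finite finite_verts by blast
  obtain S where S: "\<And>t. det (fun_mat e (card ?V) (\<lambda>x y. (if x = y then t else 0) + weighted_laplacian m x y))
        = (\<Prod>a\<in>#S. t + a)"
      "\<And>k. (\<Sum>x\<in>?V. kernel_pow ?V (weighted_laplacian m) k x x) = (\<Sum>a\<in>#S. a ^ k)"
    using spectrum_fun_mat[OF e] by blast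
  define A where "A = {f \<in> PiE ?V arc_choices. acyclic_choice f}"
  define N where "N f = {v \<in> ?V. f v = None}" for f :: "'v \<Rightarrow> 'e option"
  define W where "W f = (\<Prod>v\<in>?V - N f. m v)" for f
  define B where "B = {f \<in> A. card (N f) = 1}"
  \<comment> \<open>\<open>q\<close> collects the forests with at least two roots. On
    \<open>A - B\<close> the number of roots is neither 0 nor 1, so the subtraction of 2 does not
    truncate.\<close>
  define q where "q = (\<Sum>f\<in>A - B. monom (W f) (card (N f) - 2))"
  have finA: "finite A" using finite_choices by (simp add: A_def)
  have finN: "finite (N f)" for f by (simp add: N_def)
  have BA: "B \<subseteq> A" by (auto simp: B_def)
  have prod_N: "(\<Prod>v\<in>?V. if f v = None then t else m v) = t ^ card (N f) * W f" for f t
  proof -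
    have "(\<Prod>v\<in>?V. if f v = None then t else m v)
        = (\<Prod>v\<in>?V - N f. if f v = None then t else m v) * (\<Prod>v\<in>N f. if f v = None then t else m v)"
      by (rule prod.subset_diff) (auto simp: N_def)
    also have "(\<Prod>v\<in>?V - N f. if f v = None then t else m v) = W f"
      unfolding W_def by (intro prod.cong) (auto simp: N_def)
    also have "(\<Prod>v\<in>N f. if f v = None then t else m v) = (\<Prod>v\<in>N f. t)"
      by (intro prod.cong) (auto simp: N_def)
    finally show ?thesis by simp
  qed
  have B_eq: "B = (\<Union>r\<in>?V. rooted_choices r)"
    by (auto simp: B_def A_def N_def rooted_choices_def card_1_singleton_iff)
  have "(\<Sum>f\<in>B. W f) = (\<Sum>r\<in>?V. \<Sum>f\<in>rooted_choices r. W f)"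
    unfolding B_eq
  proof (rule sum.UNION_disjoint)
    show "\<forall>r\<in>?V. finite (rooted_choices r)"
      using finite_choices by (simp add: rooted_choices_def)
    show "\<forall>r\<in>?V. \<forall>s\<in>?V. r \<noteq> s \<longrightarrow> rooted_choices r \<inter> rooted_choices s = {}"
      by (auto simp: rooted_choices_def)
  qed simp
  also have "\<dots> = (\<Sum>r\<in>?V. \<Sum>f\<in>rooted_choices r. \<Prod>v\<in>?V - {r}. m v)"
    by (intro sum.cong refl) (simp add: W_def N_def rooted_choices_def)
  also have "\<dots> = c"
    by (simp add: c(1) card_rooted_choices sum_distrib_left)
  finally have cB: "(\<Sum>f\<in>B. W f) = c" .
  have "(\<Prod>a\<in>#S. t + a) = t * (c + t * poly q t)" for t
  proof -
    have "(\<Prod>a\<in>#S. t + a) = (\<Sum>f\<in>A. t ^ card (N f) * W f)"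
      using S(1)[of t] det_shifted_laplacian[OF e, of t m] by (simp add: prod_N A_def)
    also have "\<dots> = (\<Sum>f\<in>A - B. t ^ card (N f) * W f) + (\<Sum>f\<in>B. t ^ card (N f) * W f)"
      by (rule sum.subset_diff[OF BA finA])
    also have "(\<Sum>f\<in>B. t ^ card (N f) * W f) = (\<Sum>f\<in>B. t * W f)"
      by (intro sum.cong) (auto simp: B_def)
    also have "\<dots> = t * c"
      by (simp add: cB flip: sum_distrib_left)
    also have "(\<Sum>f\<in>A - B. t ^ card (N f) * W f) = (\<Sum>f\<in>A - B. t * (t * (W f * t ^ (card (N f) - 2))))"
    proof (intro sum.cong refl)
      fix f assume f: "f \<in> A - B"
      then have "N f \<noteq> {}" using acyclic_choice_has_root by (auto simp: A_def N_def)
      then have "card (N f) \<noteq> 0" using finN by simp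
      with f have "card (N f) = Suc (Suc (card (N f) - 2))" by (auto simp: B_def)
      then have "t ^ card (N f) = t * (t * t ^ (card (N f) - 2))" by (metis power_Suc)
      then show "t ^ card (N f) * W f = t * (t * (W f * t ^ (card (N f) - 2)))"
        by (simp only: mult_ac)
    qed
    also have "\<dots> = t * (t * poly q t)"
      by (simp add: q_def poly_sum poly_monom sum_distrib_left)
    finally show ?thesis by (simp add: algebra_simps)
  qed
  from prod_shift_linear_coeff[OF this c(2)] S(2) show ?thesis by blast
qed

end

section \<open>A Moebius identity in the group algebra\<close>

lemma sum_fun_apply: "(\<Sum>x\<in>A. f x) s = (\<Sum>x\<in>A. f x s)"
  by (induction A rule: infinite_finite_induct) auto

interpretation cfun: vector_space "\<lambda>(c::complex) (f::'g \<Rightarrow> complex) s. c * f s"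
  by unfold_locales (auto simp: algebra_simps)

text \<open>The recursion at K, with the value 1 at the least element split off from the
  sum.\<close>

lemma moebius_poset_bottom_sum:
  fixes P :: "'a::order_bot set"
  assumes "finite P" "bot \<notin> P" "K \<in> P"
  shows "(\<Sum>H\<in>{H \<in> P. H \<le> K}. moebius_poset (insert bot P) bot H) = -1"
proof -
  have K: "bot < K" using assms bot.not_eq_extremum by metis
  define mu where "mu = moebius_poset (insert bot P) bot"
  have set_eq: "{z \<in> insert bot P. bot \<le> z \<and> z < K} = insert bot {H \<in> P. H < K}"
    using K by auto
  have "mu K = - (\<Sum>z\<in>{z \<in> insert bot P. bot \<le> z \<and> z < K}. mu z)"
    unfolding mu_def using K assms(1) by (subst moebius_poset.simps) auto
  also have "\<dots> = - (mu bot + (\<Sum>H\<in>{H \<in> P. H < K}. mu H))"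
    unfolding set_eq using assms by (subst sum.insert) auto
  also have "mu bot = 1"
    unfolding mu_def by (subst moebius_poset.simps) simp
  finally have "mu K + (\<Sum>H\<in>{H \<in> P. H < K}. mu H) = -1" by simp
  moreover have "{H \<in> P. H \<le> K} = insert K {H \<in> P. H < K}"
    using assms by (auto simp: le_less)
  ultimately show ?thesis using assms by (simp add: mu_def)
qed

section \<open>The left regular representation and its minimal invariant subspaces\<close>

context group begin

text \<open>The space of the regular representation, with value 0 outside the group so that equality
  of functions means equality on the group.\<close>

definition supported :: "('a \<Rightarrow> complex) set" where
  "supported = {f. \<forall>s. s \<notin> carrier G \<longrightarrow> f s = 0}"

definition translate :: "'a \<Rightarrow> ('a \<Rightarrow> complex) \<Rightarrow> 'a \<Rightarrow> complex" where
  "translate g f s = (if s \<in> carrier G then f (inv g \<otimes> s) else 0)"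

definition invariant :: "('a \<Rightarrow> complex) set \<Rightarrow> bool" where
  "invariant U \<longleftrightarrow> cfun.subspace U \<and> (\<forall>g\<in>carrier G. \<forall>u\<in>U. translate g u \<in> U)"

lemma translate_translate:
  assumes "g \<in> carrier G" "h \<in> carrier G"
  shows "translate g (translate h f) = translate (g \<otimes> h) f"
  using assms by (auto simp: translate_def fun_eq_iff inv_mult_group m_assoc)

lemma translate_one: "f \<in> supported \<Longrightarrow> translate \<one> f = f"
  by (auto simp: translate_def supported_def fun_eq_iff)

lemma translate_linear:
  "translate g (f + f') = translate g f + translate g f'"
  "translate g (\<lambda>s. c * f s) = (\<lambda>s. c * translate g f s)"
  "translate g 0 = 0"
  by (auto simp: translate_def fun_eq_iff)

lemma invariantD:
  assumes "invariant U"
  shows "cfun.subspace U" "\<And>g u. g \<in> carrier G \<Longrightarrow> u \<in> U \<Longrightarrow> translate g u \<in> U"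
  using assms by (auto simp: invariant_def)

lemma subspace_sum_mem:
  assumes "cfun.subspace U" "\<And>i. i \<in> I \<Longrightarrow> F i \<in> U"
  shows "(\<lambda>s. \<Sum>i\<in>I. c i * F i s) \<in> U"
proof -
  have "(\<Sum>i\<in>I. (\<lambda>s. c i * F i s)) \<in> U"
    using assms by (intro cfun.subspace_sum cfun.subspace_scale) auto
  also have "(\<Sum>i\<in>I. (\<lambda>s. c i * F i s)) = (\<lambda>s. \<Sum>i\<in>I. c i * F i s)"
    by (rule ext) (simp add: sum_fun_apply)
  finally show ?thesis .
qed

lemma supported_subset_span:
  assumes "finite (carrier G)"
  shows "supported \<subseteq> cfun.span ((\<lambda>x s. of_bool (s = x)) ` carrier G)"
proof
  fix f assume f: "f \<in> supported"
  have "f = (\<lambda>s. \<Sum>x\<in>carrier G. f x * of_bool (s = x))"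
  proof
    fix s
    have "(\<Sum>x\<in>carrier G. f x * of_bool (s = x)) = (\<Sum>x\<in>carrier G. if x = s then f x else 0)"
      by (intro sum.cong) auto
    then show "f s = (\<Sum>x\<in>carrier G. f x * of_bool (s = x))"
      using f assms by (auto simp: supported_def)
  qed
  moreover have "(\<lambda>s. \<Sum>x\<in>carrier G. f x * of_bool (s = x)) \<in> cfun.span ((\<lambda>x s. of_bool (s = x)) ` carrier G)"
    by (rule subspace_sum_mem) (auto intro: cfun.span_base cfun.subspace_span)
  ultimately show "f \<in> cfun.span ((\<lambda>x s. of_bool (s = x)) ` carrier G)"
    by simp
qed

lemma finite_basis:
  assumes "finite (carrier G)" "invariant U" "U \<subseteq> supported"
  obtains B where "finite B" "cfun.independent B" "cfun.span B = U" "card B = cfun.dim U"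
proof -
  obtain B where B: "B \<subseteq> U" "cfun.independent B" "U \<subseteq> cfun.span B" "card B = cfun.dim U"
    by (rule cfun.basis_exists)
  have "B \<subseteq> cfun.span ((\<lambda>x s. of_bool (s = x)) ` carrier G)"
    using B(1) assms(3) supported_subset_span[OF assms(1)] by blast
  then have "finite B"
    using cfun.independent_span_bound[OF _ B(2)] assms(1) by blast
  moreover have "cfun.span B = U"
    using B cfun.span_minimal[OF B(1) invariantD(1)[OF assms(2)]] by blast
  ultimately show thesis using B that by blast
qed

text \<open>A nonzero invariant subspace of least dimension. A smaller one inside it has the same
  dimension, since otherwise \<open>P U'\<close> contradicts the minimum; a vector outside its span
  would then give too many independent vectors in U.\<close>

lemma exists_minimal_invariant:
  assumes fin: "finite (carrier G)" and W: "invariant W" "W \<subseteq> supported" "W \<noteq> {0}"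
  obtains U where "invariant U" "U \<subseteq> W" "U \<noteq> {0}"
    "\<And>U'. invariant U' \<Longrightarrow> U' \<subseteq> U \<Longrightarrow> U' \<noteq> {0} \<Longrightarrow> U' = U"
proof -
  define P where "P U \<longleftrightarrow> invariant U \<and> U \<subseteq> W \<and> U \<noteq> {0}" for U
  define U where "U = arg_min cfun.dim P"
  have "P W" using W by (simp add: P_def)
  then have U: "P U" unfolding U_def by (rule arg_min_natI)
  have min: "cfun.dim U \<le> cfun.dim U'" if "P U'" for U'
    using that unfolding U_def by (rule arg_min_nat_le)
  show thesis
  proof (rule that)
    show "invariant U" "U \<subseteq> W" "U \<noteq> {0}" using U by (simp_all add: P_def)
    fix U' assume U': "invariant U'" "U' \<subseteq> U" "U' \<noteq> {0}"
    then have "P U'" using U unfolding P_def by blast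
    have inv: "invariant U" "U \<subseteq> supported" "U' \<subseteq> supported"
      using U U'(2) W(2) unfolding P_def by blast+
    obtain B where B: "finite B" "cfun.independent B" "cfun.span B = U" "card B = cfun.dim U"
      by (rule finite_basis[OF fin inv(1,2)])
    obtain B' where B': "finite B'" "cfun.independent B'" "cfun.span B' = U'" "card B' = cfun.dim U'"
      by (rule finite_basis[OF fin U'(1) inv(3)])
    have "U \<subseteq> cfun.span B'"
    proof
      fix u assume u: "u \<in> U"
      show "u \<in> cfun.span B'"
      proof (rule ccontr)
        assume nu: "u \<notin> cfun.span B'"
        then have "u \<notin> B'" using cfun.span_base[of u B'] by blast
        then have "cfun.independent (insert u B')"
          using nu B'(2) cfun.independent_insert[of u B'] by simp
        moreover have "insert u B' \<subseteq> cfun.span B"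
          using u U'(2) cfun.span_superset[of B'] unfolding B(3) B'(3) by blast
        ultimately have "card (insert u B') \<le> card B"
          using cfun.independent_span_bound[OF B(1), of "insert u B'"] by simp
        with \<open>u \<notin> B'\<close> B(4) B'(1,4) min[OF \<open>P U'\<close>] show False by simp
      qed
    qed
    with U' B'(3) show "U' = U" by blast
  qed
qed

text \<open>\<open>irr_kernels\<close> is about matrix representations, so the action on U is
  written in coordinates of a basis. Minimality of U becomes irreducibility.\<close>

lemma minimal_invariant_kernel:
  assumes fin: "finite (carrier G)" and U: "invariant U" "U \<subseteq> supported" "U \<noteq> {0}"
    and min: "\<And>U'. invariant U' \<Longrightarrow> U' \<subseteq> U \<Longrightarrow> U' \<noteq> {0} \<Longrightarrow> U' = U"
  shows "{g \<in> carrier G. \<forall>u\<in>U. translate g u = u} \<in> irr_kernels G"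
proof -
  obtain B where B: "finite B" "cfun.independent B" "cfun.span B = U"
    using finite_basis[OF fin U(1,2)] by blast
  define n where "n = card B"
  obtain b where b: "bij_betw b {0..<n} B"
    using ex_bij_betw_nat_finite[OF B(1)] n_def by blast
  have bU: "b j \<in> U" if "j < n" for j
  proof -
    have "b j \<in> B" using that b by (auto simp: bij_betw_def)
    then show ?thesis using cfun.span_base[of "b j" B] B(3) by simp
  qed
  \<comment> \<open>\<open>comb\<close> is the linear bijection from coordinate vectors to U, and
    \<open>coeff\<close> below is its inverse.\<close>
  define comb where "comb v = (\<lambda>s. \<Sum>j = 0..<n. v $ j * b j s)" for v
  have comb_mem: "comb v \<in> U" for v
    unfolding comb_def using bU invariantD(1)[OF U(1)] by (intro subspace_sum_mem) auto
  have comb_add: "comb (v + w) = comb v + comb w" if "v \<in> carrier_vec n" "w \<in> carrier_vec n" for v w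
    using that by (auto simp: comb_def fun_eq_iff algebra_simps sum.distrib)
  have comb_smult: "comb (c \<cdot>\<^sub>v v) = (\<lambda>s. c * comb v s)" if "v \<in> carrier_vec n" for c v
    using that by (auto simp: comb_def fun_eq_iff algebra_simps sum_distrib_left)
  have comb_zero: "comb (0\<^sub>v n) = 0"
    by (auto simp: comb_def fun_eq_iff)
  have comb_reindex: "comb v = (\<lambda>s. \<Sum>x\<in>B. v $ inv_into {0..<n} b x * x s)" for v
  proof
    fix s
    show "comb v s = (\<Sum>x\<in>B. v $ inv_into {0..<n} b x * x s)"
      unfolding comb_def sum.reindex_bij_betw[OF b, symmetric]
      by (intro sum.cong refl) (simp add: bij_betw_inv_into_left[OF b])
  qed
  have comb_inj: "v = w" if vw: "v \<in> carrier_vec n" "w \<in> carrier_vec n" "comb v = comb w" for v w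
  proof (rule eq_vecI)
    fix j assume "j < dim_vec w"
    then have j: "j < n" using vw by simp
    define i where "i = inv_into {0..<n} b"
    have "(\<Sum>x\<in>B. (\<lambda>s. (v $ i x - w $ i x) * x s)) = 0"
      using fun_cong[OF vw(3)] unfolding comb_reindex i_def[symmetric]
      by (auto simp: fun_eq_iff sum_fun_apply algebra_simps sum_subtractf)
    then have "v $ i (b j) - w $ i (b j) = 0"
      using cfun.independentD[OF B(2) B(1) subset_refl, of "\<lambda>x. v $ i x - w $ i x" "b j"] b j
      by (auto simp: bij_betw_def)
    then show "v $ j = w $ j"
      using bij_betw_inv_into_left[OF b, of j] j by (simp add: i_def)
  qed (use vw in auto)
  have comb_surj: "\<exists>v\<in>carrier_vec n. comb v = u" if u: "u \<in> U" for u
  proof -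
    obtain c where "u = (\<Sum>x\<in>B. (\<lambda>s. c x * x s))"
      using u B(3) cfun.span_finite[OF B(1)] by auto
    then have "u = comb (vec n (\<lambda>j. c (b j)))"
      unfolding comb_def
      by (auto simp: fun_eq_iff sum_fun_apply sum.reindex_bij_betw[OF b, symmetric])
    then show ?thesis by (intro bexI[of _ "vec n (\<lambda>j. c (b j))"]) auto
  qed
  define coeff where "coeff u = (THE v. v \<in> carrier_vec n \<and> comb v = u)" for u
  have coeff: "coeff u \<in> carrier_vec n" "comb (coeff u) = u" if "u \<in> U" for u
  proof -
    have "\<exists>!v. v \<in> carrier_vec n \<and> comb v = u"
      using comb_surj[OF that] comb_inj by blast
    from theI'[OF this] show "coeff u \<in> carrier_vec n" "comb (coeff u) = u"
      by (auto simp: coeff_def)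
  qed
  have coeff_comb: "coeff (comb v) = v" if "v \<in> carrier_vec n" for v
    using comb_inj that coeff[OF comb_mem] by blast
  \<comment> \<open>The columns are the coordinates of the translated basis vectors, which makes
    \<open>comb\<close> intertwine \<open>rho g\<close> and \<open>translate g\<close>.\<close>
  define rho where "rho g = mat n n (\<lambda>(i, j). coeff (translate g (b j)) $ i)" for g
  have rho_carrier: "rho g \<in> carrier_mat n n" for g by (simp add: rho_def)
  have tb: "translate g (b j) \<in> U" if "g \<in> carrier G" "j < n" for g j
    using invariantD(2)[OF U(1)] bU that by auto
  have comb_rho: "comb (rho g *\<^sub>v v) = translate g (comb v)"
    if "g \<in> carrier G" "v \<in> carrier_vec n" for g v
  proof
    fix s
    have "comb (rho g *\<^sub>v v) s
        = (\<Sum>i = 0..<n. (\<Sum>j = 0..<n. coeff (translate g (b j)) $ i * v $ j) * b i s)"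
      using that unfolding comb_def
      by (intro sum.cong refl) (auto simp: rho_def scalar_prod_def)
    also have "\<dots> = (\<Sum>i = 0..<n. \<Sum>j = 0..<n. v $ j * (coeff (translate g (b j)) $ i * b i s))"
      by (intro sum.cong refl) (simp add: sum_distrib_left sum_distrib_right mult_ac)
    also have "\<dots> = (\<Sum>j = 0..<n. \<Sum>i = 0..<n. v $ j * (coeff (translate g (b j)) $ i * b i s))"
      by (rule sum.swap)
    also have "\<dots> = (\<Sum>j = 0..<n. v $ j * comb (coeff (translate g (b j))) s)"
      by (simp add: comb_def sum_distrib_left)
    also have "\<dots> = (\<Sum>j = 0..<n. v $ j * translate g (b j) s)"
      by (intro sum.cong refl) (simp add: coeff(2)[OF tb[OF that(1)]])
    also have "\<dots> = translate g (comb v) s"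
      by (cases "s \<in> carrier G") (simp_all add: comb_def translate_def)
    finally show "comb (rho g *\<^sub>v v) s = translate g (comb v) s" .
  qed
  have rho_col: "col (rho g) j = coeff (translate g (b j))" if "g \<in> carrier G" "j < n" for g j
    using that carrier_vecD[OF coeff(1)[OF tb[OF that]]] by (intro eq_vecI) (auto simp: rho_def)
  have rho_mult: "rho (g \<otimes> h) = rho g * rho h" if gh: "g \<in> carrier G" "h \<in> carrier G" for g h
  proof (rule mat_col_eqI)
    fix j assume "j < dim_col (rho g * rho h)"
    then have j: "j < n" by (simp add: rho_def)
    have ch: "coeff (translate h (b j)) \<in> carrier_vec n" by (rule coeff(1)[OF tb[OF gh(2) j]])
    have "comb (rho g *\<^sub>v coeff (translate h (b j))) = translate (g \<otimes> h) (b j)"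
      by (simp only: comb_rho[OF gh(1) ch] coeff(2)[OF tb[OF gh(2) j]] translate_translate[OF gh])
    then have "coeff (translate (g \<otimes> h) (b j)) = rho g *\<^sub>v coeff (translate h (b j))"
      using coeff_comb[OF mult_mat_vec_carrier[OF rho_carrier ch]] by metis
    then show "col (rho (g \<otimes> h)) j = col (rho g * rho h) j"
      by (simp only: rho_col[OF m_closed[OF gh] j] col_mult2[OF rho_carrier rho_carrier j] rho_col[OF gh(2) j])
  qed (auto simp: rho_def)
  have coeff_b: "coeff (b j) = unit_vec n j" if "j < n" for j
  proof -
    have "comb (unit_vec n j) = b j"
    proof
      fix s
      have "comb (unit_vec n j) s = (\<Sum>i = 0..<n. if i = j then b i s else 0)"
        unfolding comb_def using that by (intro sum.cong) auto
      then show "comb (unit_vec n j) s = b j s" using that by simp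
    qed
    then show ?thesis using coeff_comb[of "unit_vec n j"] by simp
  qed
  have rho_id: "rho g = 1\<^sub>m n" if "g \<in> carrier G" "\<And>u. u \<in> U \<Longrightarrow> translate g u = u" for g
    using that bU coeff_b by (intro mat_col_eqI) (auto simp: rho_col, auto simp: rho_def)
  have rho_one: "rho \<one> = 1\<^sub>m n"
    using U(2) by (intro rho_id) (auto simp: translate_one)
  have rho_hom: "rho \<in> hom G (GL n)"
  proof (rule homI)
    fix g assume g: "g \<in> carrier G"
    have "rho (inv g) * rho g = 1\<^sub>m n" "rho g * rho (inv g) = 1\<^sub>m n"
      using g rho_mult[of g "inv g"] rho_mult[of "inv g" g] by (simp_all add: rho_one)
    then show "rho g \<in> carrier (GL n)"
      using rho_carrier by (auto simp: GL_def units_of_def Units_def ring_mat_def)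
  qed (simp add: rho_mult GL_def units_of_def ring_mat_def)
  have "n \<noteq> 0"
  proof
    assume "n = 0"
    then have "B = {}" using B(1) by (simp add: n_def)
    with B(3) U(3) show False by simp
  qed
  \<comment> \<open>A stable subspace of coordinates is carried by \<open>comb\<close> to an
    invariant subspace of U, where \<open>min\<close> applies.\<close>
  have "W = {0\<^sub>v n} \<or> W = carrier_vec n"
    if W: "VectorSpace.subspace class_ring W (module_vec TYPE(complex) n)"
      and stab: "\<forall>g\<in>carrier G. \<forall>w\<in>W. rho g *\<^sub>v w \<in> W" for W
  proof -
    have Wc: "W \<subseteq> carrier_vec n" and Wz: "0\<^sub>v n \<in> W"
      and Wa: "\<And>v w. v \<in> W \<Longrightarrow> w \<in> W \<Longrightarrow> v + w \<in> W" and Ws: "\<And>c v. v \<in> W \<Longrightarrow> c \<cdot>\<^sub>v v \<in> W"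
      using W by (auto simp: VectorSpace.subspace_def submodule_def module_vec_simps)
    have "invariant (comb ` W)"
      unfolding invariant_def cfun.subspace_def
    proof (intro conjI ballI allI)
      show "0 \<in> comb ` W" using Wz comb_zero by (metis imageI)
      fix x y assume "x \<in> comb ` W" "y \<in> comb ` W"
      then show "x + y \<in> comb ` W"
        using Wa Wc by (auto simp: comb_add[symmetric] subset_iff)
    next
      fix c x assume "x \<in> comb ` W"
      then show "(\<lambda>s. c * x s) \<in> comb ` W"
        using Ws Wc by (auto simp: comb_smult[symmetric] subset_iff)
    next
      fix g u assume "g \<in> carrier G" "u \<in> comb ` W"
      then show "translate g u \<in> comb ` W"
        using stab Wc by (auto simp: comb_rho[symmetric] subset_iff)
    qed
    then have "comb ` W = {0} \<or> comb ` W = U"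
      using min[of "comb ` W"] comb_mem by blast
    then show ?thesis
    proof
      assume zero: "comb ` W = {0}"
      have "w = 0\<^sub>v n" if "w \<in> W" for w
      proof (rule comb_inj)
        have "comb w \<in> comb ` W" using that by (rule imageI)
        then show "comb w = comb (0\<^sub>v n)" using zero comb_zero by simp
      qed (use that Wc in auto)
      with Wz show ?thesis by blast
    next
      assume eq: "comb ` W = U"
      have "v \<in> W" if v: "v \<in> carrier_vec n" for v
      proof -
        obtain w where "w \<in> W" "comb v = comb w" using comb_mem[of v] eq by blast
        then show ?thesis using comb_inj[of v w] v Wc by blast
      qed
      with Wc show ?thesis by blast
    qed
  qed
  then have irr: "irreducible_rep G n rho"
    using rho_hom \<open>n \<noteq> 0\<close> unfolding irreducible_rep_def by blast
  have "Coset.kernel G (GL n) rho = {g \<in> carrier G. \<forall>u\<in>U. translate g u = u}"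
  proof -
    have "translate g u = u" if "g \<in> carrier G" "rho g = 1\<^sub>m n" "u \<in> U" for g u
      using comb_rho[OF that(1) coeff(1)[OF that(3)]] coeff[OF that(3)] that(2) by simp
    then show ?thesis
      using rho_id by (auto simp: kernel_def GL_def units_of_def ring_mat_def)
  qed
  with irr show ?thesis unfolding irr_kernels_def by blast
qed

lemma irr_kernels_normal: "H \<in> irr_kernels G \<Longrightarrow> H \<lhd> G"
proof -
  assume "H \<in> irr_kernels G"
  then obtain n rho where rho: "rho \<in> hom G (GL n)" "H = Coset.kernel G (GL n) rho"
    by (auto simp: irr_kernels_def irreducible_rep_def)
  interpret R: ring "ring_mat TYPE(complex) n ()" by (rule ring_mat)
  have "group (GL n)" unfolding GL_def by (rule R.units_group)
  then have "group_hom G (GL n) rho"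
    by (intro group_hom.intro group_hom_axioms.intro is_group rho(1))
  then show "H \<lhd> G" unfolding rho(2) by (rule group_hom.normal_kernel)
qed

lemma finite_irr_kernels:
  assumes "finite (carrier G)"
  shows "finite (irr_kernels G)"
proof (rule finite_subset)
  show "irr_kernels G \<subseteq> Pow (carrier G)"
    unfolding irr_kernels_def kernel_def by blast
qed (use assms in simp)

section \<open>Averages over normal subgroups and the Moebius operator\<close>

text \<open>The action of the group algebra element \<open>e_H\<close>.\<close>

definition average :: "'a set \<Rightarrow> ('a \<Rightarrow> complex) \<Rightarrow> 'a \<Rightarrow> complex" where
  "average H f s = (\<Sum>h\<in>H. translate h f s) / of_nat (card H)"

definition scalar :: "('a \<Rightarrow> complex) \<Rightarrow> ('a \<Rightarrow> complex) \<Rightarrow> complex" where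
  "scalar f f' = (\<Sum>s\<in>carrier G. f s * cnj (f' s))"

lemma average_linear:
  "average H (f + f') = average H f + average H f'"
  "average H (\<lambda>s. c * f s) = (\<lambda>s. c * average H f s)"
  "average H 0 = 0"
  by (auto simp: average_def fun_eq_iff translate_linear sum.distrib add_divide_distrib sum_distrib_left)

lemma average_supported: "average H f \<in> supported"
  by (simp add: average_def supported_def translate_def)

text \<open>Conjugation by g permutes the normal subgroup H, so \<open>e_H\<close> is
  central.\<close>

lemma translate_average:
  assumes H: "H \<lhd> G" and g: "g \<in> carrier G"
  shows "translate g (average H f) = average H (translate g f)"
proof
  fix s
  have sub: "h \<in> carrier G" if "h \<in> H" for h
    using H that normal_imp_subgroup subgroup.mem_carrier by metis
  have bij: "bij_betw (\<lambda>h. g \<otimes> h \<otimes> inv g) H H"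
  proof (rule bij_betw_byWitness[where f' = "\<lambda>h. inv g \<otimes> h \<otimes> g"])
    show "(\<lambda>h. g \<otimes> h \<otimes> inv g) ` H \<subseteq> H"
      using normal.inv_op_closed2[OF H g] by auto
    show "(\<lambda>h. inv g \<otimes> h \<otimes> g) ` H \<subseteq> H"
      using normal.inv_op_closed1[OF H g] by auto
  qed (use g sub in \<open>auto simp: m_assoc\<close>, use g sub in \<open>auto simp flip: m_assoc\<close>)
  have "translate g (average H f) s = (\<Sum>h\<in>H. translate g (translate h f) s) / of_nat (card H)"
    by (simp add: translate_def average_def)
  also have "(\<Sum>h\<in>H. translate g (translate h f) s) = (\<Sum>h\<in>H. translate (g \<otimes> h \<otimes> inv g) (translate g f) s)"
    using g sub by (intro sum.cong refl) (simp add: translate_translate m_assoc)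
  also have "\<dots> = (\<Sum>h\<in>H. translate h (translate g f) s)"
    by (rule sum.reindex_bij_betw[OF bij])
  finally show "translate g (average H f) s = average H (translate g f) s"
    unfolding average_def[of H "translate g f" s] .
qed

lemma translate_average_mem:
  assumes H: "subgroup H G" and g: "g \<in> H"
  shows "translate g (average H f) = average H f"
proof
  fix s
  have sub: "h \<in> carrier G" if "h \<in> H" for h
    using H that subgroup.mem_carrier by metis
  have bij: "bij_betw (\<lambda>h. g \<otimes> h) H H"
  proof (rule bij_betw_byWitness[where f' = "\<lambda>h. inv g \<otimes> h"])
    show "(\<lambda>h. g \<otimes> h) ` H \<subseteq> H"
      using subgroup.m_closed[OF H g] by auto
    show "(\<lambda>h. inv g \<otimes> h) ` H \<subseteq> H"
      using subgroup.m_closed[OF H subgroup.m_inv_closed[OF H g]] by auto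
  qed (use g sub in \<open>auto simp flip: m_assoc\<close>)
  have "translate g (average H f) s = (\<Sum>h\<in>H. translate g (translate h f) s) / of_nat (card H)"
    by (simp add: translate_def average_def)
  also have "(\<Sum>h\<in>H. translate g (translate h f) s) = (\<Sum>h\<in>H. translate (g \<otimes> h) f s)"
    using g sub by (intro sum.cong refl) (simp add: translate_translate)
  also have "\<dots> = (\<Sum>h\<in>H. translate h f s)"
    by (rule sum.reindex_bij_betw[OF bij])
  finally show "translate g (average H f) s = average H f s"
    unfolding average_def[of H f s] .
qed

lemma average_fixed:
  assumes "finite H" "H \<noteq> {}" "\<And>h. h \<in> H \<Longrightarrow> translate h u = u"
  shows "average H u = u"
  using assms by (simp add: average_def fun_eq_iff)

text \<open>Translations are unitary, by the substitution of g s for s.\<close>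

lemma scalar_translate:
  assumes g: "g \<in> carrier G"
  shows "scalar (translate g f) f' = scalar f (translate (inv g) f')"
proof -
  have bij: "bij_betw (\<lambda>s. g \<otimes> s) (carrier G) (carrier G)"
    by (rule bij_betw_byWitness[where f' = "\<lambda>s. inv g \<otimes> s"]) (use g in \<open>auto simp flip: m_assoc\<close>)
  have "scalar (translate g f) f' = (\<Sum>s\<in>carrier G. translate g f (g \<otimes> s) * cnj (f' (g \<otimes> s)))"
    unfolding scalar_def by (rule sum.reindex_bij_betw[OF bij, symmetric])
  also have "\<dots> = scalar f (translate (inv g) f')"
    unfolding scalar_def using g by (intro sum.cong refl) (simp add: translate_def flip: m_assoc)
  finally show ?thesis .
qed

text \<open>The adjoint of a translation is the translation by the inverse, and inversion permutes
  H.\<close>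

lemma scalar_average:
  assumes H: "subgroup H G"
  shows "scalar (average H f) f' = scalar f (average H f')"
proof -
  have sub: "h \<in> carrier G" if "h \<in> H" for h
    using H that subgroup.mem_carrier by metis
  have bij: "bij_betw (\<lambda>h. inv h) H H"
    by (rule bij_betw_byWitness[where f' = "\<lambda>h. inv h"]) (use subgroup.m_inv_closed[OF H] sub in auto)
  have "scalar (average H f) f' = (\<Sum>s\<in>carrier G. \<Sum>h\<in>H. translate h f s * cnj (f' s)) / of_nat (card H)"
    by (simp add: scalar_def average_def sum_distrib_right sum_divide_distrib)
  also have "(\<Sum>s\<in>carrier G. \<Sum>h\<in>H. translate h f s * cnj (f' s)) = (\<Sum>h\<in>H. scalar (translate h f) f')"
    unfolding scalar_def by (rule sum.swap)
  also have "\<dots> = (\<Sum>h\<in>H. scalar f (translate (inv h) f'))"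
    using sub by (intro sum.cong refl scalar_translate)
  also have "\<dots> = (\<Sum>h\<in>H. scalar f (translate h f'))"
    by (rule sum.reindex_bij_betw[OF bij])
  also have "\<dots> = (\<Sum>s\<in>carrier G. \<Sum>h\<in>H. f s * cnj (translate h f' s))"
    unfolding scalar_def by (rule sum.swap)
  also have "\<dots> / of_nat (card H) = scalar f (average H f')"
    by (simp add: scalar_def average_def sum_distrib_left sum_divide_distrib)
  finally show ?thesis .
qed

text \<open>The difference between the two sides of the Moebius identity, which is to be shown
  zero.\<close>

definition moebius_operator :: "('a \<Rightarrow> complex) \<Rightarrow> 'a \<Rightarrow> complex" where
  "moebius_operator f s = f s +
     (\<Sum>H\<in>irr_kernels G. of_int (moebius_poset (insert {} (irr_kernels G)) {} H) * average H f s)"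

lemma moebius_operator_linear:
  "moebius_operator (f + f') = moebius_operator f + moebius_operator f'"
  "moebius_operator (\<lambda>s. c * f s) = (\<lambda>s. c * moebius_operator f s)"
  "moebius_operator 0 = 0"
  by (auto simp: moebius_operator_def fun_eq_iff average_linear algebra_simps sum.distrib sum_distrib_left)

lemma moebius_operator_supported: "f \<in> supported \<Longrightarrow> moebius_operator f \<in> supported"
  using average_supported by (auto simp: moebius_operator_def supported_def)

lemma translate_moebius_operator:
  assumes g: "g \<in> carrier G"
  shows "translate g (moebius_operator f) = moebius_operator (translate g f)"
proof
  fix s
  show "translate g (moebius_operator f) s = moebius_operator (translate g f) s"
  proof (cases "s \<in> carrier G")
    case True
    have "average H f (inv g \<otimes> s) = average H (translate g f) s" if "H \<in> irr_kernels G" for H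
      using fun_cong[OF translate_average[OF irr_kernels_normal[OF that] g, of f], of s] True
      by (simp add: translate_def)
    then show ?thesis using True by (simp add: moebius_operator_def translate_def)
  next
    case False
    then show ?thesis
      using average_supported by (auto simp: moebius_operator_def translate_def supported_def)
  qed
qed

lemma scalar_moebius_operator: "scalar (moebius_operator f) f' = scalar f (moebius_operator f')"
proof -
  define mu where "mu = moebius_poset (insert {} (irr_kernels G)) {}"
  have "scalar (moebius_operator f) f' = scalar f f' + (\<Sum>s\<in>carrier G. \<Sum>H\<in>irr_kernels G. of_int (mu H) * (average H f s * cnj (f' s)))"
    by (simp add: scalar_def moebius_operator_def mu_def algebra_simps sum.distrib sum_distrib_left sum_distrib_right)
  also have "(\<Sum>s\<in>carrier G. \<Sum>H\<in>irr_kernels G. of_int (mu H) * (average H f s * cnj (f' s)))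
      = (\<Sum>H\<in>irr_kernels G. of_int (mu H) * scalar (average H f) f')"
    unfolding scalar_def by (subst sum.swap) (simp add: sum_distrib_left)
  also have "\<dots> = (\<Sum>H\<in>irr_kernels G. of_int (mu H) * scalar f (average H f'))"
    using irr_kernels_normal normal_imp_subgroup by (intro sum.cong refl arg_cong2[where f = "(*)"] scalar_average) blast
  also have "\<dots> = (\<Sum>s\<in>carrier G. \<Sum>H\<in>irr_kernels G. of_int (mu H) * (f s * cnj (average H f' s)))"
    unfolding scalar_def by (subst sum.swap) (simp add: sum_distrib_left)
  also have "scalar f f' + \<dots> = scalar f (moebius_operator f')"
    by (simp add: scalar_def moebius_operator_def mu_def algebra_simps sum.distrib sum_distrib_left sum_distrib_right)
  finally show ?thesis .
qed

lemma scalar_self_eq_0: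
  assumes "finite (carrier G)" "f \<in> supported" "scalar f f = 0"
  shows "f = 0"
proof
  fix s
  have "scalar f f = of_real (\<Sum>s\<in>carrier G. (cmod (f s))\<^sup>2)"
    unfolding scalar_def of_real_sum complex_norm_square ..
  with assms(3) have "(\<Sum>s\<in>carrier G. (cmod (f s))\<^sup>2) = 0"
    by (metis of_real_eq_0_iff)
  then have "s \<in> carrier G \<Longrightarrow> f s = 0"
    using assms(1) by (subst (asm) sum_nonneg_eq_0_iff) auto
  then show "f s = 0 s" using assms(2) by (auto simp: supported_def)
qed

text \<open>Let K be the kernel of the action on U. For H inside K the average fixes U. Otherwise
  its image is an invariant subspace of U, by normality of H, on which H acts trivially; it differs
  from U and is therefore 0. The operator thus acts as 1 plus the sum of the Moebius values over H
  below K, which is 1 - 1.\<close>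

lemma moebius_operator_minimal:
  assumes fin: "finite (carrier G)" and U: "invariant U" "U \<subseteq> supported" "U \<noteq> {0}"
    and min: "\<And>U'. invariant U' \<Longrightarrow> U' \<subseteq> U \<Longrightarrow> U' \<noteq> {0} \<Longrightarrow> U' = U"
    and u: "u \<in> U"
  shows "moebius_operator u = 0"
proof -
  define mu where "mu = moebius_poset (insert {} (irr_kernels G)) {}"
  define K where "K = {g \<in> carrier G. \<forall>u\<in>U. translate g u = u}"
  have K: "K \<in> irr_kernels G"
    unfolding K_def using minimal_invariant_kernel[OF fin U min] .
  have avg: "average H u = (if H \<subseteq> K then u else 0)" if H: "H \<in> irr_kernels G" for H
  proof -
    have nH: "H \<lhd> G" by (rule irr_kernels_normal[OF H])
    have sH: "subgroup H G" by (rule normal_imp_subgroup[OF nH])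
    have Hc: "H \<subseteq> carrier G" by (rule subgroup.subset[OF sH])
    have finH: "finite H" using finite_subset[OF Hc fin] .
    have neH: "H \<noteq> {}" using subgroup.one_closed[OF sH] by blast
    show ?thesis
    proof (cases "H \<subseteq> K")
      case True
      then have "translate h u = u" if "h \<in> H" for h
        using that u by (auto simp: K_def)
      then show ?thesis using True average_fixed[OF finH neH] by simp
    next
      case False
      note sub = invariantD(1)[OF U(1)]
      have avgU: "average H v \<in> U" if "v \<in> U" for v
      proof -
        have "(\<lambda>s. \<Sum>h\<in>H. (1 / of_nat (card H)) * translate h v s) \<in> U"
          by (rule subspace_sum_mem[OF sub]) (use invariantD(2)[OF U(1)] Hc that in auto)
        also have "(\<lambda>s. \<Sum>h\<in>H. (1 / of_nat (card H)) * translate h v s) = average H v"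
          by (simp add: average_def fun_eq_iff sum_divide_distrib)
        finally show ?thesis .
      qed
      have "invariant (average H ` U)"
        unfolding invariant_def cfun.subspace_def
      proof (intro conjI ballI allI)
        show "0 \<in> average H ` U"
          using average_linear(3) cfun.subspace_0[OF sub] by (metis imageI)
        fix x y assume "x \<in> average H ` U" "y \<in> average H ` U"
        then show "x + y \<in> average H ` U"
          using cfun.subspace_add[OF sub] by (auto simp flip: average_linear(1))
      next
        fix c x assume "x \<in> average H ` U"
        then show "(\<lambda>s. c * x s) \<in> average H ` U"
          using cfun.subspace_scale[OF sub] by (auto simp flip: average_linear(2))
      next
        fix g x assume "g \<in> carrier G" "x \<in> average H ` U"
        then show "translate g x \<in> average H ` U"
          using invariantD(2)[OF U(1)] by (auto simp: translate_average[OF nH])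
      qed
      moreover have "average H ` U \<subseteq> U" using avgU by blast
      \<comment> \<open>H fixes every average over H, so averages filling U would put H inside
        K.\<close>
      moreover have "average H ` U \<noteq> U"
      proof
        assume eq: "average H ` U = U"
        have "translate h v = v" if hv: "h \<in> H" "v \<in> U" for h v
        proof -
          obtain v' where "v = average H v'" using eq hv(2) by blast
          then show ?thesis using translate_average_mem[OF sH hv(1)] by simp
        qed
        then have "H \<subseteq> K" using Hc by (auto simp: K_def)
        with False show False by simp
      qed
      ultimately have "average H ` U = {0}" using min by blast
      then have "average H u = 0" using u by blast
      then show ?thesis using False by simp
    qed
  qed
  show ?thesis
  proof
    fix s
    have "(\<Sum>H\<in>irr_kernels G. of_int (mu H) * average H u s)
        = (\<Sum>H\<in>irr_kernels G. if H \<subseteq> K then of_int (mu H) * u s else 0)"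
      by (intro sum.cong refl) (simp add: avg)
    also have "\<dots> = (\<Sum>H\<in>{H \<in> irr_kernels G. H \<subseteq> K}. of_int (mu H) * u s)"
      using finite_irr_kernels[OF fin] by (simp add: sum.inter_filter)
    also have "\<dots> = of_int (\<Sum>H\<in>{H \<in> irr_kernels G. H \<subseteq> K}. mu H) * u s"
      by (simp add: sum_distrib_right)
    also have "(\<Sum>H\<in>{H \<in> irr_kernels G. H \<subseteq> K}. mu H) = -1"
    proof -
      have "{} \<notin> irr_kernels G"
        using irr_kernels_normal normal_imp_subgroup subgroup.one_closed by blast
      then show ?thesis
        using moebius_poset_bottom_sum[OF finite_irr_kernels[OF fin] _ K] by (simp add: mu_def)
    qed
    finally show "moebius_operator u s = 0 s" by (simp add: moebius_operator_def mu_def)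
  qed
qed

text \<open>A single minimal invariant subspace of the image is enough. For u = x v in it, with x
  the operator, self-adjointness gives \<open>scalar u u = scalar v (x u)\<close>, and x u =
  0.\<close>

lemma moebius_operator_eq_0:
  assumes fin: "finite (carrier G)" and f: "f \<in> supported"
  shows "moebius_operator f = 0"
proof -
  define W where "W = moebius_operator ` supported"
  have "W \<subseteq> supported" unfolding W_def using moebius_operator_supported by blast
  have "cfun.subspace (supported :: ('a \<Rightarrow> complex) set)"
    by (auto simp: cfun.subspace_def supported_def)
  note sub = this
  have "invariant W"
    unfolding invariant_def cfun.subspace_def W_def
  proof (intro conjI ballI allI)
    show "0 \<in> moebius_operator ` supported"
      using moebius_operator_linear(3) cfun.subspace_0[OF sub] by (metis imageI)
    fix x y assume "x \<in> moebius_operator ` supported" "y \<in> moebius_operator ` supported"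
    then show "x + y \<in> moebius_operator ` supported"
      using cfun.subspace_add[OF sub] by (auto simp flip: moebius_operator_linear(1))
  next
    fix c x assume "x \<in> moebius_operator ` supported"
    then show "(\<lambda>s. c * x s) \<in> moebius_operator ` supported"
      using cfun.subspace_scale[OF sub] by (auto simp flip: moebius_operator_linear(2))
  next
    fix g x assume "g \<in> carrier G" "x \<in> moebius_operator ` supported"
    moreover have "translate g v \<in> supported" for v by (simp add: translate_def supported_def)
    ultimately show "translate g x \<in> moebius_operator ` supported"
      by (auto simp: translate_moebius_operator)
  qed
  have "W = {0}"
  proof (rule ccontr)
    assume "W \<noteq> {0}"
    then obtain U where U: "invariant U" "U \<subseteq> W" "U \<noteq> {0}"
      "\<And>U'. invariant U' \<Longrightarrow> U' \<subseteq> U \<Longrightarrow> U' \<noteq> {0} \<Longrightarrow> U' = U"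
      using exists_minimal_invariant[OF fin \<open>invariant W\<close> \<open>W \<subseteq> supported\<close>] by blast
    have US: "U \<subseteq> supported" using U(2) \<open>W \<subseteq> supported\<close> by blast
    have "u = 0" if u: "u \<in> U" for u
    proof -
      obtain v where v: "u = moebius_operator v" using u U(2) by (auto simp: W_def)
      have "scalar u u = scalar v (moebius_operator u)"
        using scalar_moebius_operator[of v u] v by simp
      also have "moebius_operator u = 0"
        by (rule moebius_operator_minimal[OF fin U(1) US U(3) U(4) u])
      finally have "scalar u u = 0" by (simp add: scalar_def)
      then show "u = 0" using scalar_self_eq_0[OF fin] u US by blast
    qed
    moreover have "0 \<in> U" using cfun.subspace_0[OF invariantD(1)[OF U(1)]] .
    ultimately show False using U(3) by blast
  qed
  then show ?thesis using f unfolding W_def by blast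
qed

text \<open>The operator identity applied to the indicator function of the unit element and
  evaluated at g: the average of this function over H is 1 / |H| on H and 0 elsewhere.\<close>

lemma sum_moebius_irr_kernels:
  assumes fin: "finite (carrier G)" and g: "g \<in> carrier G"
  shows "(\<Sum>H\<in>irr_kernels G. of_int (moebius_poset (insert {} (irr_kernels G)) {} H)
      * (of_bool (g \<in> H) / of_nat (card H))) = - (of_bool (g = \<one>) :: complex)"
proof -
  define d where "d s = (of_bool (s = \<one>) :: complex)" for s
  have "d \<in> supported" by (auto simp: d_def supported_def)
  have avg: "average H d g = of_bool (g \<in> H) / of_nat (card H)" if H: "H \<in> irr_kernels G" for H
  proof -
    have Hc: "H \<subseteq> carrier G"
      using subgroup.subset[OF normal_imp_subgroup[OF irr_kernels_normal[OF H]]] .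
    then have finH: "finite H" using fin finite_subset by blast
    have "translate h d g = (if h = g then 1 else 0)" if "h \<in> H" for h
    proof -
      have "inv h \<otimes> g = \<one> \<longleftrightarrow> h = g"
        using that Hc g inv_equality[of "inv h" g] by (metis inv_inv l_inv inv_closed subsetD)
      then show ?thesis using g by (simp add: translate_def d_def)
    qed
    then have "(\<Sum>h\<in>H. translate h d g) = (\<Sum>h\<in>H. if h = g then 1 else 0)"
      by (intro sum.cong refl)
    then show ?thesis using finH by (simp add: average_def)
  qed
  have "moebius_operator d g = 0"
    using moebius_operator_eq_0[OF fin \<open>d \<in> supported\<close>] by simp
  then have "d g = - (\<Sum>H\<in>irr_kernels G. of_int (moebius_poset (insert {} (irr_kernels G)) {} H) * average H d g)"
    by (simp add: moebius_operator_def eq_neg_iff_add_eq_0)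
  then show ?thesis by (simp add: avg d_def)
qed

end

section \<open>Quotients of graphs\<close>

lemma (in group_action) orbit_eq_iff:
  assumes "x \<in> E" "y \<in> E"
  shows "Group_Action.orbit G \<phi> x = Group_Action.orbit G \<phi> y \<longleftrightarrow> y \<in> Group_Action.orbit G \<phi> x"
proof
  assume "Group_Action.orbit G \<phi> x = Group_Action.orbit G \<phi> y"
  then show "y \<in> Group_Action.orbit G \<phi> x" using orbit_refl[OF assms(2)] by simp
next
  assume "y \<in> Group_Action.orbit G \<phi> x"
  then have "y \<in> Group_Action.orbit G \<phi> x \<inter> Group_Action.orbit G \<phi> y"
    using orbit_refl[OF assms(2)] by simp
  moreover have "Group_Action.orbit G \<phi> x \<in> orbits G E \<phi>" "Group_Action.orbit G \<phi> y \<in> orbits G E \<phi>"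
    using assms by (auto simp: orbits_def)
  ultimately show "Group_Action.orbit G \<phi> x = Group_Action.orbit G \<phi> y"
    using disjoint_union by blast
qed

lemma (in group_action) orbit_subset: "x \<in> E \<Longrightarrow> Group_Action.orbit G \<phi> x \<subseteq> E"
  using element_image by (auto simp: Group_Action.orbit_def)

text \<open>The fibres of the map from g to the image of x under g are the left cosets of the
  stabilizer of x.\<close>

lemma (in group_action) sum_group_orbit:
  fixes F :: "'c \<Rightarrow> 'd::comm_semiring_1"
  assumes fin: "finite (carrier G)" and x: "x \<in> E"
  shows "(\<Sum>g\<in>carrier G. F (\<phi> g x))
    = of_nat (card (stabilizer G \<phi> x)) * (\<Sum>u\<in>Group_Action.orbit G \<phi> x. F u)"
proof -
  interpret group G using group_hom group_hom.axioms(1) by blast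
  define S where "S = stabilizer G \<phi> x"
  have fiber: "card {g \<in> carrier G. \<phi> g x = u} = card S" if u: "u \<in> Group_Action.orbit G \<phi> x" for u
  proof -
    obtain g0 where g0: "g0 \<in> carrier G" "u = \<phi> g0 x"
      using u by (auto simp: Group_Action.orbit_def)
    have cancel: "\<phi> (inv g0 \<otimes> g) x = x" if "g \<in> carrier G" "\<phi> g x = u" for g
      using that g0 x composition_rule[of x "inv g0" g] orbit_sym_aux[OF g0(1) x] by simp
    have "bij_betw (\<lambda>s. g0 \<otimes> s) S {g \<in> carrier G. \<phi> g x = u}"
    proof (rule bij_betw_byWitness[where f' = "\<lambda>g. inv g0 \<otimes> g"])
      show "(\<lambda>s. g0 \<otimes> s) ` S \<subseteq> {g \<in> carrier G. \<phi> g x = u}"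
        using g0 x by (auto simp: S_def stabilizer_def composition_rule)
      show "(\<lambda>g. inv g0 \<otimes> g) ` {g \<in> carrier G. \<phi> g x = u} \<subseteq> S"
        using g0 cancel by (auto simp: S_def stabilizer_def)
    qed (use g0 in \<open>auto simp: S_def stabilizer_def simp flip: m_assoc\<close>)
    then show ?thesis by (simp add: bij_betw_same_card)
  qed
  have orb: "(\<lambda>g. \<phi> g x) ` carrier G = Group_Action.orbit G \<phi> x"
    by (auto simp: Group_Action.orbit_def)
  have "(\<Sum>g\<in>carrier G. F (\<phi> g x))
      = (\<Sum>u\<in>Group_Action.orbit G \<phi> x. \<Sum>g\<in>{g \<in> carrier G. \<phi> g x = u}. F (\<phi> g x))"
    unfolding orb[symmetric] by (rule sum.image_gen[OF fin])
  also have "\<dots> = (\<Sum>u\<in>Group_Action.orbit G \<phi> x. of_nat (card S) * F u)"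
    by (intro sum.cong refl) (simp add: fiber)
  finally show ?thesis by (simp add: S_def sum_distrib_left)
qed

text \<open>The situation of a subgroup acting on the top graph of a cover. By
  \<open>no_inversion\<close> the involution of the quotient has no fixed points, by
  \<open>free\<close> arc fibres are counted by stabilizers, and \<open>faithful\<close> settles the
  graph without arcs.\<close>

locale inversion_free_action =
  Y: finite_connected_graph Y revY +
  actV: group_action K "verts Y" phiV + actE: group_action K "arcs Y" phiE
  for K :: "('g, 'm) monoid_scheme" (structure)
    and Y :: "('w, 'f) pre_digraph" and revY
    and phiV :: "'g \<Rightarrow> 'w \<Rightarrow> 'w" and phiE :: "'g \<Rightarrow> 'f \<Rightarrow> 'f" +
  assumes fin: "finite (carrier K)"
    and act_tail: "\<lbrakk>g \<in> carrier K; a \<in> arcs Y\<rbrakk> \<Longrightarrow> tail Y (phiE g a) = phiV g (tail Y a)"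
    and act_head: "\<lbrakk>g \<in> carrier K; a \<in> arcs Y\<rbrakk> \<Longrightarrow> head Y (phiE g a) = phiV g (head Y a)"
    and act_rev: "\<lbrakk>g \<in> carrier K; a \<in> arcs Y\<rbrakk> \<Longrightarrow> revY (phiE g a) = phiE g (revY a)"
    and faithful:
      "\<lbrakk>g \<in> carrier K; \<forall>w \<in> verts Y. phiV g w = w; \<forall>a \<in> arcs Y. phiE g a = a\<rbrakk> \<Longrightarrow> g = \<one>"
    and free: "\<lbrakk>g \<in> carrier K; a \<in> arcs Y; phiE g a = a\<rbrakk> \<Longrightarrow> g = \<one>"
    and no_inversion: "\<lbrakk>g \<in> carrier K; a \<in> arcs Y\<rbrakk> \<Longrightarrow> phiE g a \<noteq> revY a"
begin

abbreviation "orbV \<equiv> Group_Action.orbit K phiV"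
abbreviation "orbE \<equiv> Group_Action.orbit K phiE"
abbreviation "quot \<equiv> quotient_graph K phiV phiE Y"
abbreviation "quot_rev \<equiv> quotient_rev K phiE Y revY"

sublocale K: group K
  using actV.group_hom group_hom.axioms(1) by blast

lemma verts_quot: "verts quot = orbV ` verts Y"
  by (auto simp: quotient_graph_def orbits_def)

lemma arcs_quot: "arcs quot = orbE ` arcs Y"
  by (auto simp: quotient_graph_def orbits_def)

lemma orbit_image: "Group_Action.orbit K phi x = (\<lambda>g. phi g x) ` carrier K"
  by (auto simp: Group_Action.orbit_def)

lemma tail_quot: "a \<in> arcs Y \<Longrightarrow> tail quot (orbE a) = orbV (tail Y a)"
  by (simp add: quotient_graph_def orbit_image image_image act_tail cong: image_cong)

lemma head_quot: "a \<in> arcs Y \<Longrightarrow> head quot (orbE a) = orbV (head Y a)"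
  by (simp add: quotient_graph_def orbit_image image_image act_head cong: image_cong)

lemma quot_rev_orbit:
  assumes "a \<in> arcs Y"
  shows "quot_rev (orbE a) = orbE (revY a)"
proof -
  have "orbE a \<in> orbits K (arcs Y) phiE" using assms unfolding orbits_def by blast
  then have "quot_rev (orbE a) = revY ` orbE a" by (simp add: quotient_rev_def)
  also have "\<dots> = orbE (revY a)"
    using assms by (simp add: orbit_image image_image act_rev cong: image_cong)
  finally show ?thesis .
qed

lemma quot_connected:
  assumes wf: "wf_digraph quot"
  shows "Digraph_Component.connected quot"
proof -
  interpret Q: wf_digraph quot by (rule wf)
  have "spanning Y Y" using Y.subgraph_refl by (simp add: spanning_def)
  then have "symmetric Y" by (rule Y.bidirected_subgraph(6)) auto
  then have sc: "strongly_connected Y"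
    using Y.symmetric_connected_imp_strongly_connected Y.connected by blast
  have reach: "orbV u \<rightarrow>\<^sup>*\<^bsub>quot\<^esub> orbV v" if "u \<rightarrow>\<^sup>*\<^bsub>Y\<^esub> v" for u v
    using that
  proof (induction rule: Y.reachable_induct)
    case base
    then show ?case by (auto simp: verts_quot)
  next
    case (step x y)
    then obtain a where a: "a \<in> arcs Y" "x = tail Y a" "y = head Y a"
      by (auto simp: arcs_ends_conv)
    then have "orbE a \<in> arcs quot" by (simp add: arcs_quot)
    moreover have "arc_to_ends quot (orbE a) = (orbV x, orbV y)"
      using a by (simp add: arc_to_ends_def tail_quot head_quot)
    ultimately have "orbV x \<rightarrow>\<^bsub>quot\<^esub> orbV y"
      unfolding arcs_ends_def by (metis image_eqI)
    with step.IH show ?case by (rule Q.reachable_adj_trans)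
  qed
  show ?thesis
  proof (rule Q.connectedI)
    show "verts quot \<noteq> {}" using Y.verts_nonempty by (simp add: verts_quot)
    fix A B assume "A \<in> verts quot" "B \<in> verts quot"
    then obtain u v where "A = orbV u" "B = orbV v" "u \<in> verts Y" "v \<in> verts Y"
      by (auto simp: verts_quot)
    then have "A \<rightarrow>\<^sup>*\<^bsub>quot\<^esub> B" using reach sc by (simp add: strongly_connected_def)
    then show "A \<rightarrow>\<^sup>*\<^bsub>mk_symmetric quot\<^esub> B" by (rule Q.reachable_mk_symmetricI)
  qed
qed

lemma quot_finite_connected_graph: "finite_connected_graph quot quot_rev"
proof -
  have wf: "wf_digraph quot"
    by unfold_locales (auto simp: verts_quot arcs_quot tail_quot head_quot)
  interpret Q: wf_digraph quot by (rule wf)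
  have "fin_digraph quot"
    by unfold_locales (auto simp: verts_quot arcs_quot)
  moreover have "bidirected_digraph quot quot_rev"
  proof (rule Q.bidirected_digraphI)
    fix A assume "A \<notin> arcs quot"
    then show "quot_rev A = A" by (auto simp: quotient_rev_def quotient_graph_def)
  next
    fix A assume "A \<in> arcs quot"
    then obtain a where a: "a \<in> arcs Y" "A = orbE a" by (auto simp: arcs_quot)
    show "quot_rev A \<noteq> A"
    proof
      assume "quot_rev A = A"
      then have "revY a \<in> orbE a"
        using a actE.orbit_eq_iff[of a "revY a"] by (simp add: quot_rev_orbit)
      then obtain g where "g \<in> carrier K" "revY a = phiE g a"
        unfolding Group_Action.orbit_def by blast
      with no_inversion[OF _ a(1)] show False by metis
    qed
    show "quot_rev (quot_rev A) = A" using a by (simp add: quot_rev_orbit)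
    show "tail quot (quot_rev A) = head quot A"
      using a by (simp add: quot_rev_orbit tail_quot head_quot)
  qed
  ultimately show ?thesis
    using quot_connected[OF wf]
    by (simp add: finite_connected_graph_def finite_connected_graph_axioms_def)
qed

sublocale Q: finite_connected_graph quot quot_rev
  by (rule quot_finite_connected_graph)

definition stab_card :: "'w \<Rightarrow> nat" where
  "stab_card w = card (stabilizer K phiV w)"

lemma finite_stabilizer: "finite (stabilizer K phiV w)"
  by (rule finite_subset[OF actV.stabilizer_subset fin])

lemma stab_card_pos: "w \<in> verts Y \<Longrightarrow> 0 < stab_card w"
  using actV.stabilizer_one_closed[of w] finite_stabilizer[of w] by (auto simp: stab_card_def card_gt_0_iff)

lemma card_orbit_stab: "w \<in> verts Y \<Longrightarrow> card (orbV w) * stab_card w = card (carrier K)"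
  using actV.orbit_stabilizer_theorem by (simp add: stab_card_def Coset.order_def)

lemma finite_orbit: "finite (orbV w)"
  using fin by (simp add: orbit_image)

lemma card_orbit_pos: "w \<in> verts Y \<Longrightarrow> 0 < card (orbV w)"
  using actV.orbit_refl[of w] finite_orbit[of w] by (auto simp: card_gt_0_iff)

lemma stab_card_orbit:
  assumes "w \<in> verts Y" "u \<in> verts Y" "orbV w = orbV u"
  shows "stab_card w = stab_card u"
proof -
  have "card (orbV w) * stab_card w = card (orbV w) * stab_card u"
    using card_orbit_stab[OF assms(1)] card_orbit_stab[OF assms(2)] assms(3) by simp
  then show ?thesis using card_orbit_pos[OF assms(1)] by simp
qed

text \<open>The arcs that leave w over a given arc of the quotient form one free orbit of the
  stabilizer of w: a group element relating two of them fixes their common tail.\<close>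

lemma card_fiber:
  assumes w: "w \<in> verts Y" and e: "e \<in> out_arcs quot (orbV w)"
  shows "card {f \<in> out_arcs Y w. orbE f = e} = stab_card w"
proof -
  obtain b where b: "b \<in> arcs Y" "e = orbE b" using e by (auto simp: arcs_quot)
  then have "orbV (tail Y b) = orbV w" using e tail_quot by simp
  then have "w \<in> orbV (tail Y b)" using actV.orbit_refl[OF w] by simp
  then obtain g where g: "g \<in> carrier K" "phiV g (tail Y b) = w"
    by (auto simp: Group_Action.orbit_def)
  \<comment> \<open>A representative \<open>b\<close> only starts in the orbit of \<open>w\<close>;
    it is moved so as to start in \<open>w\<close> itself.\<close>
  define a where "a = phiE g b"
  have a: "a \<in> arcs Y" "tail Y a = w"
    using g b(1) actE.element_image[OF g(1) b(1)] act_tail by (auto simp: a_def)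
  have "a \<in> orbE b" using g(1) by (auto simp: a_def Group_Action.orbit_def)
  then have ea: "orbE a = e" using actE.orbit_eq_iff[OF b(1) a(1)] b(2) by simp
  have "bij_betw (\<lambda>h. phiE h a) (stabilizer K phiV w) {f \<in> out_arcs Y w. orbE f = e}"
    unfolding bij_betw_def
  proof
    show "inj_on (\<lambda>h. phiE h a) (stabilizer K phiV w)"
    proof (rule inj_onI)
      fix h k assume "h \<in> stabilizer K phiV w" "k \<in> stabilizer K phiV w" and eq: "phiE h a = phiE k a"
      then have hk: "h \<in> carrier K" "k \<in> carrier K" by (auto simp: stabilizer_def)
      have "phiE (inv k \<otimes> h) a = a"
        using hk a(1) eq actE.composition_rule[of a "inv k" h] actE.orbit_sym_aux[OF hk(2) a(1)] by simp
      then have "inv k \<otimes> h = \<one>" using free a(1) hk by simp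
      then have "inv h = inv k" using hk K.inv_equality[of "inv k" h] by simp
      then show "h = k" using hk K.inv_inv by metis
    qed
    show "(\<lambda>h. phiE h a) ` stabilizer K phiV w = {f \<in> out_arcs Y w. orbE f = e}"
    proof safe
      fix h assume "h \<in> stabilizer K phiV w"
      then have h: "h \<in> carrier K" "phiV h w = w" by (auto simp: stabilizer_def)
      have m: "phiE h a \<in> arcs Y" using actE.element_image[OF h(1) a(1)] by simp
      then show "phiE h a \<in> out_arcs Y w" using act_tail[OF h(1) a(1)] h a by simp
      have "phiE h a \<in> orbE a" using h(1) by (auto simp: Group_Action.orbit_def)
      then have eq: "orbE (phiE h a) = e" using actE.orbit_eq_iff[OF a(1) m] ea by simp
      show "x \<in> e" if "x \<in> orbE (phiE h a)" for x using that eq by simp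
      show "x \<in> orbE (phiE h a)" if "x \<in> e" for x using that eq by simp
    next
      fix f assume f: "f \<in> out_arcs Y w" and fe: "e = orbE f"
      then have "f \<in> orbE a" using actE.orbit_eq_iff[OF a(1), of f] ea by simp
      then obtain h where h: "h \<in> carrier K" "f = phiE h a" by (auto simp: Group_Action.orbit_def)
      then have "phiV h w = w" using act_tail[OF h(1) a(1)] a f by simp
      then show "f \<in> (\<lambda>h. phiE h a) ` stabilizer K phiV w" using h by (auto simp: stabilizer_def)
    qed
  qed
  then show ?thesis by (simp add: stab_card_def bij_betw_same_card)
qed

lemma sum_out_arcs_quot:
  fixes F :: "'f set \<Rightarrow> complex"
  assumes w: "w \<in> verts Y"
  shows "(\<Sum>f\<in>out_arcs Y w. F (orbE f)) = of_nat (stab_card w) * (\<Sum>e\<in>out_arcs quot (orbV w). F e)"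
proof -
  have sub: "orbE ` out_arcs Y w \<subseteq> out_arcs quot (orbV w)"
    by (auto simp: arcs_quot tail_quot)
  have "(\<Sum>f\<in>out_arcs Y w. F (orbE f))
      = (\<Sum>e\<in>out_arcs quot (orbV w). \<Sum>f\<in>{f \<in> out_arcs Y w. orbE f = e}. F (orbE f))"
    by (rule sum.group[symmetric, OF Y.finite_out_arcs Q.finite_out_arcs sub])
  also have "\<dots> = (\<Sum>e\<in>out_arcs quot (orbV w). of_nat (stab_card w) * F e)"
  proof (intro sum.cong refl)
    fix e assume e: "e \<in> out_arcs quot (orbV w)"
    have "(\<Sum>f\<in>{f \<in> out_arcs Y w. orbE f = e}. F (orbE f)) = (\<Sum>f\<in>{f \<in> out_arcs Y w. orbE f = e}. F e)"
      by (rule sum.cong) auto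
    also have "\<dots> = of_nat (card {f \<in> out_arcs Y w. orbE f = e}) * F e"
      by (rule sum_constant)
    finally show "(\<Sum>f\<in>{f \<in> out_arcs Y w. orbE f = e}. F (orbE f)) = of_nat (stab_card w) * F e"
      unfolding card_fiber[OF w e] .
  qed
  finally show ?thesis by (simp add: sum_distrib_left)
qed

text \<open>This is the case of the convention m = 1. By connectedness such a vertex is the whole
  graph, so its stabilizer acts trivially and faithfulness applies.\<close>

lemma stab_card_isolated:
  assumes w: "w \<in> verts Y" and empty: "out_arcs quot (orbV w) = {}"
  shows "stab_card w = 1"
proof -
  have "out_arcs Y w = {}"
    using empty by (auto simp: out_arcs_def arcs_quot tail_quot)
  then have no: "tail Y a \<noteq> w" if "a \<in> arcs Y" for a
    using that by (auto simp: out_arcs_def)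
  have no': "head Y a \<noteq> w" if "a \<in> arcs Y" for a
    using no[of "revY a"] Y.tail_arev[OF that] Y.arev_in_arcs[OF that] by metis
  have only: "v = w" if v: "v \<in> verts Y" for v
  proof -
    have "(w, v) \<in> rtrancl_on (verts Y) ((arcs_ends Y)\<^sup>s)"
      using Y.connected w v by (auto simp: connected_conv)
    then show "v = w"
    proof (cases rule: converse_rtrancl_on_cases)
      case (step u)
      then show ?thesis using no no' by (auto simp: symcl_def arcs_ends_conv)
    qed simp
  qed
  have V: "verts Y = {w}"
  proof
    show "verts Y \<subseteq> {w}" using only by (metis singletonI subsetI)
  qed (use w in simp)
  then have A: "arcs Y = {}" using no Y.tail_in_verts by blast
  have "stabilizer K phiV w = {\<one>}"
  proof
    show "stabilizer K phiV w \<subseteq> {\<one>}"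
      using faithful V A by (auto simp: stabilizer_def)
  qed (use actV.stabilizer_one_closed[OF w] in simp)
  then show ?thesis by (simp add: stab_card_def)
qed

lemma ramification_index_quot:
  assumes w: "w \<in> verts Y"
  shows "ramification_index Y quot orbV orbE w = stab_card w"
  unfolding ramification_index_def
proof (rule the_equality)
  show "is_ramification_index Y quot orbV orbE w (stab_card w)"
    unfolding is_ramification_index_def
    using stab_card_pos[OF w] card_fiber[OF w] stab_card_isolated[OF w] by simp
  fix m assume m: "is_ramification_index Y quot orbV orbE w m"
  show "m = stab_card w"
  proof (cases "out_arcs quot (orbV w) = {}")
    case True
    then show ?thesis using m stab_card_isolated[OF w] by (simp add: is_ramification_index_def)
  next
    case False
    then obtain e where "e \<in> out_arcs quot (orbV w)" by blast
    then show ?thesis using m card_fiber[OF w] by (auto simp: is_ramification_index_def)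
  qed
qed

definition quot_ram :: "'w set \<Rightarrow> nat" where
  "quot_ram = base_ramification_index Y quot orbV orbE"

lemma quot_ram_orbit:
  assumes w: "w \<in> verts Y"
  shows "quot_ram (orbV w) = stab_card w"
proof -
  define u where "u = (SOME u. u \<in> verts Y \<and> orbV u = orbV w)"
  have "u \<in> verts Y \<and> orbV u = orbV w"
    unfolding u_def by (rule someI[of _ w]) (simp add: w)
  then show ?thesis
    using ramification_index_quot stab_card_orbit w
    unfolding quot_ram_def base_ramification_index_def u_def[symmetric] by metis
qed

lemma card_quot_vertex:
  assumes "x \<in> verts quot"
  shows "card x * quot_ram x = card (carrier K)" "0 < quot_ram x" "0 < card x" "finite x" "x \<subseteq> verts Y"
proof -
  obtain w where w: "w \<in> verts Y" "x = orbV w" using assms unfolding verts_quot by blast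
  show "card x * quot_ram x = card (carrier K)"
    unfolding w(2) quot_ram_orbit[OF w(1)] by (rule card_orbit_stab[OF w(1)])
  show "0 < quot_ram x" unfolding w(2) quot_ram_orbit[OF w(1)] by (rule stab_card_pos[OF w(1)])
  show "0 < card x" unfolding w(2) by (rule card_orbit_pos[OF w(1)])
  show "finite x" unfolding w(2) by (rule finite_orbit)
  show "x \<subseteq> verts Y" unfolding w(2) by (rule actV.orbit_subset[OF w(1)])
qed

lemma orbV_eqI:
  assumes "x \<in> verts quot" "w \<in> x"
  shows "orbV w = x"
proof -
  obtain u where u: "u \<in> verts Y" "x = orbV u" using assms by (auto simp: verts_quot)
  then have "w \<in> verts Y" using assms(2) actV.orbit_subset by blast
  then show ?thesis using actV.orbit_eq_iff[OF u(1), of w] u assms(2) by simp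
qed

lemma sum_verts_quot:
  fixes F :: "'w \<Rightarrow> 'c::comm_monoid_add"
  shows "(\<Sum>x\<in>verts quot. \<Sum>w\<in>x. F w) = (\<Sum>w\<in>verts Y. F w)"
proof -
  have "(\<Sum>x\<in>verts quot. \<Sum>w\<in>x. F w) = (\<Sum>x\<in>verts quot. \<Sum>w\<in>{w \<in> verts Y. orbV w = x}. F w)"
  proof (intro sum.cong refl)
    fix x assume x: "x \<in> verts quot"
    show "x = {w \<in> verts Y. orbV w = x}"
      using orbV_eqI[OF x] card_quot_vertex(5)[OF x] actV.orbit_refl by auto
  qed
  also have "\<dots> = (\<Sum>w\<in>verts Y. F w)"
    by (rule sum.group) (auto simp: verts_quot)
  finally show ?thesis .
qed

section \<open>The Laplacian on invariant functions\<close>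

text \<open>The Laplacian of \<open>Y\<close> applied to the indicator function of the orbit y. The
  value at w depends on the orbit of w alone, and the weight appears because over each outgoing arc
  of that orbit there lie \<open>stab_card w\<close> arcs leaving w.\<close>

lemma quot_laplacian:
  assumes w: "w \<in> verts Y" and y: "y \<in> verts quot"
  shows "Q.weighted_laplacian (\<lambda>x. of_nat (quot_ram x)) (orbV w) y = (\<Sum>u\<in>y. Y.weighted_laplacian (\<lambda>_. 1) w u)"
proof -
  have finy: "finite y" by (rule card_quot_vertex(4)[OF y])
  have mem: "v \<in> y \<longleftrightarrow> orbV v = y" if "v \<in> verts Y" for v
    using orbV_eqI[OF y, of v] actV.orbit_refl[OF that] by auto
  define F where "F e = (of_bool (orbV w = y) - of_bool (head quot e = y) :: complex)" for e
  have "(\<Sum>u\<in>y. Y.weighted_laplacian (\<lambda>_. 1) w u)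
      = (\<Sum>a\<in>out_arcs Y w. \<Sum>u\<in>y. of_bool (w = u) - of_bool (head Y a = u))"
    unfolding Y.weighted_laplacian_def by (simp add: sum.swap[of _ y])
  also have "\<dots> = (\<Sum>a\<in>out_arcs Y w. F (orbE a))"
  proof (intro sum.cong refl)
    fix a assume a: "a \<in> out_arcs Y w"
    have one: "(\<Sum>u\<in>y. of_bool (v = u)) = (of_bool (v \<in> y) :: complex)" for v
      using finy by (simp add: of_bool_def)
    have "(\<Sum>u\<in>y. of_bool (w = u) - of_bool (head Y a = u)) = (of_bool (w \<in> y) - of_bool (head Y a \<in> y) :: complex)"
      by (simp add: sum_subtractf one)
    also have "\<dots> = F (orbE a)"
      using a w mem by (simp add: F_def head_quot)
    finally show "(\<Sum>u\<in>y. of_bool (w = u) - of_bool (head Y a = u)) = F (orbE a)" .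
  qed
  also have "\<dots> = of_nat (stab_card w) * (\<Sum>e\<in>out_arcs quot (orbV w). F e)"
    by (rule sum_out_arcs_quot[OF w])
  also have "\<dots> = Q.weighted_laplacian (\<lambda>x. of_nat (quot_ram x)) (orbV w) y"
    by (simp add: Q.weighted_laplacian_def F_def quot_ram_orbit[OF w])
  finally show ?thesis by simp
qed

text \<open>Entries summed over an orbit of columns depend only on the orbit of the row, so these
  sums multiply like matrices on the quotient.\<close>

lemma quot_kernel_pow:
  assumes w: "w \<in> verts Y" and y: "y \<in> verts quot"
  shows "kernel_pow (verts quot) (Q.weighted_laplacian (\<lambda>x. of_nat (quot_ram x))) k (orbV w) y
    = (\<Sum>u\<in>y. kernel_pow (verts Y) (Y.weighted_laplacian (\<lambda>_. 1)) k w u)"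
  using y
proof (induction k arbitrary: y)
  case 0
  have "orbV w = y \<longleftrightarrow> w \<in> y"
    using orbV_eqI[OF 0, of w] actV.orbit_refl[OF w] by auto
  then show ?case using card_quot_vertex(4)[OF 0] by simp
next
  case (Suc k)
  let ?L = "Y.weighted_laplacian (\<lambda>_. 1)" and ?N = "Q.weighted_laplacian (\<lambda>x. of_nat (quot_ram x))"
  let ?P = "\<lambda>u. kernel_pow (verts Y) ?L k w u"
  have "kernel_pow (verts quot) ?N (Suc k) (orbV w) y
      = (\<Sum>z\<in>verts quot. (\<Sum>u\<in>z. ?P u) * ?N z y)"
    using Suc.IH by simp
  also have "\<dots> = (\<Sum>z\<in>verts quot. \<Sum>u\<in>z. ?P u * (\<Sum>u'\<in>y. ?L u u'))"
  proof (intro sum.cong refl)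
    fix z assume z: "z \<in> verts quot"
    have "?N z y = (\<Sum>u'\<in>y. ?L u u')" if "u \<in> z" for u
      using quot_laplacian[of u y] Suc.prems orbV_eqI[OF z that] card_quot_vertex(5)[OF z] that by auto
    then show "(\<Sum>u\<in>z. ?P u) * ?N z y = (\<Sum>u\<in>z. ?P u * (\<Sum>u'\<in>y. ?L u u'))"
      by (simp add: sum_distrib_right)
  qed
  also have "\<dots> = (\<Sum>u\<in>verts Y. ?P u * (\<Sum>u'\<in>y. ?L u u'))"
    by (rule sum_verts_quot)
  also have "\<dots> = (\<Sum>u\<in>verts Y. \<Sum>u'\<in>y. ?P u * ?L u u')"
    by (simp add: sum_distrib_left)
  also have "\<dots> = (\<Sum>u'\<in>y. kernel_pow (verts Y) ?L (Suc k) w u')"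
    by (subst sum.swap) simp
  finally show ?case .
qed

text \<open>The trace on invariant functions equals the trace of the Laplacian power composed with
  the averaging projection. For w in x the sum over the group runs through the orbit
  \<open>quot_ram x\<close> times, and this number times the length of x is the group order.\<close>

lemma trace_quot_kernel_pow:
  "(\<Sum>x\<in>verts quot. kernel_pow (verts quot) (Q.weighted_laplacian (\<lambda>x. of_nat (quot_ram x))) k x x)
    = (\<Sum>g\<in>carrier K. \<Sum>w\<in>verts Y. kernel_pow (verts Y) (Y.weighted_laplacian (\<lambda>_. 1)) k w (phiV g w))
      / of_nat (card (carrier K))"
proof -
  let ?P = "kernel_pow (verts Y) (Y.weighted_laplacian (\<lambda>_. 1)) k"
  let ?N = "kernel_pow (verts quot) (Q.weighted_laplacian (\<lambda>x. of_nat (quot_ram x))) k"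
  let ?h = "of_nat (card (carrier K)) :: complex"
  have "(\<Sum>x\<in>verts quot. ?N x x) = (\<Sum>x\<in>verts quot. \<Sum>w\<in>x. (\<Sum>g\<in>carrier K. ?P w (phiV g w)) / ?h)"
  proof (intro sum.cong refl)
    fix x assume x: "x \<in> verts quot"
    have "(\<Sum>g\<in>carrier K. ?P w (phiV g w)) / ?h = ?N x x / of_nat (card x)" if "w \<in> x" for w
    proof -
      have w: "w \<in> verts Y" using card_quot_vertex(5)[OF x] that by blast
      have ow: "orbV w = x" by (rule orbV_eqI[OF x that])
      have "(\<Sum>g\<in>carrier K. ?P w (phiV g w)) = of_nat (quot_ram x) * ?N x x"
        using actV.sum_group_orbit[OF fin w, of "?P w"] quot_kernel_pow[OF w x] quot_ram_orbit[OF w]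
        by (simp add: ow stab_card_def)
      moreover have "?h = of_nat (card x) * of_nat (quot_ram x)"
        using card_quot_vertex(1)[OF x] by (metis of_nat_mult)
      ultimately show ?thesis using card_quot_vertex(2)[OF x] by simp
    qed
    then have "(\<Sum>w\<in>x. (\<Sum>g\<in>carrier K. ?P w (phiV g w)) / ?h) = (\<Sum>w\<in>x. ?N x x / of_nat (card x))"
      by (intro sum.cong refl)
    then show "?N x x = (\<Sum>w\<in>x. (\<Sum>g\<in>carrier K. ?P w (phiV g w)) / ?h)"
      using card_quot_vertex(3)[OF x] by simp
  qed
  also have "\<dots> = (\<Sum>w\<in>verts Y. (\<Sum>g\<in>carrier K. ?P w (phiV g w)) / ?h)"
    by (rule sum_verts_quot)
  also have "\<dots> = (\<Sum>w\<in>verts Y. \<Sum>g\<in>carrier K. ?P w (phiV g w)) / ?h"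
    by (simp add: sum_divide_distrib)
  also have "(\<Sum>w\<in>verts Y. \<Sum>g\<in>carrier K. ?P w (phiV g w)) = (\<Sum>g\<in>carrier K. \<Sum>w\<in>verts Y. ?P w (phiV g w))"
    by (rule sum.swap)
  finally show ?thesis .
qed

text \<open>The product of the nonzero eigenvalues of the Laplacian on invariant functions, as
  \<open>quot_spectrum\<close> shows.\<close>

definition quot_const :: real where
  "quot_const = real (kappa quot quot_rev) * (\<Prod>x\<in>verts quot. real (quot_ram x))
     * real (card (verts Y)) / real (card (carrier K))"

lemma quot_const_pos: "0 < quot_const"
proof -
  have "0 < card (verts Y)" using Y.verts_nonempty by (simp add: card_gt_0_iff)
  moreover have "0 < card (carrier K)" using K.one_closed fin by (auto simp: card_gt_0_iff)
  ultimately show ?thesis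
    unfolding quot_const_def using Q.kappa_pos card_quot_vertex(2) by (simp add: prod_pos)
qed

text \<open>In the coefficient from the matrix tree theorem, omitting the weight of r multiplies the
  full product by |r| / |K|, since |r| times the weight of r is |K|. The orbit lengths add up to the
  number of vertices of \<open>Y\<close>.\<close>

lemma quot_spectrum:
  "\<exists>S :: complex multiset.
    (\<forall>k. (\<Sum>a\<in>#S. a ^ k) =
      (\<Sum>g\<in>carrier K. \<Sum>w\<in>verts Y. kernel_pow (verts Y) (Y.weighted_laplacian (\<lambda>_. 1)) k w (phiV g w))
      / of_nat (card (carrier K))) \<and>
    count S 0 = 1 \<and> (\<Prod>a\<in>#filter_mset (\<lambda>a. a \<noteq> 0) S. a) = of_real quot_const"
proof -
  let ?h = "of_nat (card (carrier K)) :: complex"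
  let ?m = "\<lambda>x. of_nat (quot_ram x) :: complex"
  have "(\<Sum>r\<in>verts quot. \<Prod>v\<in>verts quot - {r}. ?m v)
      = (\<Sum>r\<in>verts quot. (\<Prod>v\<in>verts quot. ?m v) * of_nat (card r) / ?h)"
  proof (intro sum.cong refl)
    fix r assume r: "r \<in> verts quot"
    have "(\<Prod>v\<in>verts quot. ?m v) = ?m r * (\<Prod>v\<in>verts quot - {r}. ?m v)"
      using r by (intro prod.remove) auto
    moreover have "?h = of_nat (card r) * ?m r"
      using card_quot_vertex(1)[OF r] by (metis of_nat_mult)
    ultimately show "(\<Prod>v\<in>verts quot - {r}. ?m v) = (\<Prod>v\<in>verts quot. ?m v) * of_nat (card r) / ?h"
      using card_quot_vertex(2,3)[OF r] by (simp add: field_simps)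
  qed
  also have "\<dots> = (\<Prod>v\<in>verts quot. ?m v) * of_nat (\<Sum>r\<in>verts quot. card r) / ?h"
    by (simp add: sum_distrib_left sum_divide_distrib)
  also have "(\<Sum>r\<in>verts quot. card r) = card (verts Y)"
    using sum_verts_quot[of "\<lambda>_. 1 :: nat"] by simp
  finally have c: "complex_of_real quot_const
      = of_nat (kappa quot quot_rev) * (\<Sum>r\<in>verts quot. \<Prod>v\<in>verts quot - {r}. ?m v)"
    by (simp add: quot_const_def)
  have nz: "complex_of_real quot_const \<noteq> 0" using quot_const_pos by simp
  have m: "?m v \<noteq> 0" if "v \<in> verts quot" for v using card_quot_vertex(2)[OF that] by simp
  show ?thesis
    using Q.weighted_laplacian_spectrum[OF m c nz] unfolding trace_quot_kernel_pow by metis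
qed

end

section \<open>Galois covers\<close>

lemma (in group_action) subgroup_action:
  assumes "subgroup H G"
  shows "group_action (G\<lparr>carrier := H\<rparr>) E \<phi>"
  unfolding group_action_def group_hom_def group_hom_axioms_def
proof (intro conjI)
  interpret group_hom G "BijGroup E" \<phi> by (rule group_hom)
  show "group (G\<lparr>carrier := H\<rparr>)" by (rule subgroup.subgroup_is_group[OF assms G.group_axioms])
  show "group (BijGroup E)" by (rule H.group_axioms)
  show "\<phi> \<in> hom (G\<lparr>carrier := H\<rparr>) (BijGroup E)"
    using homh subgroup.mem_carrier[OF assms] by (auto simp: hom_def)
qed

section \<open>Comparison of the spectra for a Galois cover\<close>

context galois_cover begin

text \<open>An element taking an arc to its reverse would make the arc of \<open>X\<close> below it
  equal to its own reverse.\<close>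

lemma inversion_free_subgroup:
  assumes fin: "finite (carrier G)" and H: "subgroup H G"
  shows "inversion_free_action (G\<lparr>carrier := H\<rparr>) Y revY phiV phiE"
proof -
  have mem: "h \<in> carrier G" if "h \<in> H" for h using subgroup.mem_carrier[OF H that] .
  have "group_action (G\<lparr>carrier := H\<rparr>) (verts Y) phiV" by (rule actV.subgroup_action[OF H])
  moreover have "group_action (G\<lparr>carrier := H\<rparr>) (arcs Y) phiE" by (rule actE.subgroup_action[OF H])
  moreover have "inversion_free_action_axioms (G\<lparr>carrier := H\<rparr>) Y revY phiV phiE"
  proof
    show "finite (carrier (G\<lparr>carrier := H\<rparr>))"
      using fin subgroup.subset[OF H] finite_subset by auto
    fix g a assume "g \<in> carrier (G\<lparr>carrier := H\<rparr>)" and a: "a \<in> arcs Y"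
    then have g: "g \<in> carrier G" using mem by simp
    show "tail Y (phiE g a) = phiV g (tail Y a)" by (rule act_tail[OF g a])
    show "head Y (phiE g a) = phiV g (head Y a)" by (rule act_head[OF g a])
    show "revY (phiE g a) = phiE g (revY a)" by (rule act_rev[OF g a])
    show "g = \<one>\<^bsub>G\<lparr>carrier := H\<rparr>\<^esub>" if "phiE g a = a" using piE_free[OF g a that] by simp
    show "phiE g a \<noteq> revY a"
    proof
      assume "phiE g a = revY a"
      then have "piE a = revX (piE a)" using piE_stable[OF g a] rev_piE[OF a] by simp
      then show False using X.arev_neq[OF piE_arcs[OF a]] by simp
    qed
  next
    fix g assume "g \<in> carrier (G\<lparr>carrier := H\<rparr>)"
      "\<forall>w\<in>verts Y. phiV g w = w" "\<forall>a\<in>arcs Y. phiE g a = a"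
    then show "g = \<one>\<^bsub>G\<lparr>carrier := H\<rparr>\<^esub>" using faithful mem by simp
  qed
  ultimately show ?thesis
    using Y.finite_connected_graph_axioms by (intro inversion_free_action.intro)
qed

lemma base_ramification_index_pos:
  assumes "v \<in> verts X"
  shows "0 < base_ramification_index Y X piV piE v"
proof -
  define w where "w = (SOME w. w \<in> verts Y \<and> piV w = v)"
  have "v \<in> piV ` verts Y" using assms piV_surj by simp
  then obtain w0 where "w0 \<in> verts Y \<and> piV w0 = v" by blast
  then have w: "w \<in> verts Y" unfolding w_def by (rule someI2) simp
  obtain m where m: "is_ramification_index Y X piV piE w m" using ramified[OF w] by blast
  have "m' = m" if m': "is_ramification_index Y X piV piE w m'" for m'
  proof (cases "out_arcs X (piV w) = {}")
    case True
    then show ?thesis using m m' unfolding is_ramification_index_def by simp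
  next
    case False
    then obtain e where e: "e \<in> out_arcs X (piV w)" by blast
    then show ?thesis using m m' unfolding is_ramification_index_def by (metis (no_types, lifting))
  qed
  with m have "ramification_index Y X piV piE w = m"
    unfolding ramification_index_def by (rule the_equality)
  with m show ?thesis
    by (simp add: base_ramification_index_def w_def[symmetric] is_ramification_index_def)
qed

end

theorem theorem1p1:
  fixes G :: "('g, 'm) monoid_scheme"
    and Y :: "('w, 'f) pre_digraph" and revY :: "'f \<Rightarrow> 'f"
    and X :: "('v, 'e) pre_digraph" and revX :: "'e \<Rightarrow> 'e"
    and piV :: "'w \<Rightarrow> 'v" and piE :: "'f \<Rightarrow> 'e"
    and phiV :: "'g \<Rightarrow> 'w \<Rightarrow> 'w" and phiE :: "'g \<Rightarrow> 'f \<Rightarrow> 'f"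
  assumes "group G" and "finite (carrier G)"
    and "galois_cover G Y revY X revX piV piE phiV phiE"
  shows "real (kappa Y revY) =
    1 / real (Coset.order G) *
    (\<Prod>v \<in> verts X. real (base_ramification_index Y X piV piE v)) *
    (\<Prod>H \<in> irr_kernels G.
      (real (card (rcosets\<^bsub>G\<^esub> H)) * real (kappa_quotient G phiV phiE Y revY H) /
         ramification_factor G Y X piV piE phiV phiE H)
      powi (- moebius_poset (insert {} (irr_kernels G)) {} H))"
proof -
  interpret G: group G by (rule assms(1))
  note fin = assms(2)
  interpret galois_cover G Y revY X revX piV piE phiV phiE by (rule assms(3))
  define mu where "mu = moebius_poset (insert {} (irr_kernels G)) {}"
  define IK where "IK = irr_kernels G"
  define P where "P = kernel_pow (verts Y) (Y.weighted_laplacian (\<lambda>_. 1))"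
  \<comment> \<open>\<open>T k g\<close> is the trace of the k-th power of the Laplacian composed
    with the action of g; at the unit element it is the trace of the power itself.\<close>
  define T where "T k g = (\<Sum>w\<in>verts Y. P k w (phiV g w))" for k g
  define n where "n = card (verts Y)"
  define C where "C H = inversion_free_action.quot_const (G\<lparr>carrier := H\<rparr>) Y revY phiV phiE" for H
  have n: "0 < n" using Y.verts_nonempty by (simp add: n_def card_gt_0_iff)
  have finIK: "finite IK" unfolding IK_def by (rule G.finite_irr_kernels[OF fin])
  have sub: "subgroup H G" if "H \<in> IK" for H
    using that G.irr_kernels_normal normal_imp_subgroup unfolding IK_def by blast
  have action: "inversion_free_action (G\<lparr>carrier := H\<rparr>) Y revY phiV phiE" if "H \<in> IK" for H
    by (rule inversion_free_subgroup[OF fin sub[OF that]])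

  \<comment> \<open>With all weights 1 each of the n roots contributes the same term, so the nonzero
    eigenvalues of the Laplacian of \<open>Y\<close> multiply to n times
    \<open>kappa Y revY\<close>.\<close>
  have c0: "of_nat (kappa Y revY) * of_nat n
      = of_nat (kappa Y revY) * (\<Sum>r\<in>verts Y. \<Prod>v\<in>verts Y - {r}. 1 :: complex)"
    by (simp add: n_def)
  have "of_nat (kappa Y revY) * of_nat n \<noteq> (0 :: complex)"
    using Y.kappa_pos n by simp
  note Y.weighted_laplacian_spectrum[of "\<lambda>_. 1", OF _ c0 this]
  then obtain S0 :: "complex multiset" where S0: "\<forall>k. (\<Sum>v\<in>verts Y. P k v v) = (\<Sum>a\<in>#S0. a ^ k)"
      "count S0 0 = 1" "(\<Prod>a\<in>#filter_mset (\<lambda>a. a \<noteq> 0) S0. a) = of_nat (kappa Y revY) * of_nat n"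
    unfolding P_def by auto
  have "\<forall>H\<in>IK. \<exists>S :: complex multiset. (\<forall>k. (\<Sum>a\<in>#S. a ^ k) = (\<Sum>g\<in>H. T k g) / of_nat (card H)) \<and>
      count S 0 = 1 \<and> (\<Prod>a\<in>#filter_mset (\<lambda>a. a \<noteq> 0) S. a) = of_real (C H)"
  proof
    fix H assume "H \<in> IK"
    from inversion_free_action.quot_spectrum[OF action[OF this]]
    show "\<exists>S :: complex multiset. (\<forall>k. (\<Sum>a\<in>#S. a ^ k) = (\<Sum>g\<in>H. T k g) / of_nat (card H)) \<and>
      count S 0 = 1 \<and> (\<Prod>a\<in>#filter_mset (\<lambda>a. a \<noteq> 0) S. a) = of_real (C H)"
      unfolding T_def P_def C_def by simp
  qed
  from bchoice[OF this] obtain S where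
    S_all: "\<forall>H\<in>IK. (\<forall>k. (\<Sum>a\<in>#S H. a ^ k) = (\<Sum>g\<in>H. T k g) / of_nat (card H)) \<and>
      count (S H) 0 = 1 \<and> (\<Prod>a\<in>#filter_mset (\<lambda>a. a \<noteq> 0) (S H). a) = of_real (C H)"
    by blast
  have S: "(\<Sum>a\<in>#S H. a ^ k) = (\<Sum>g\<in>H. T k g) / of_nat (card H)"
      "count (S H) 0 = 1" "(\<Prod>a\<in>#filter_mset (\<lambda>a. a \<noteq> 0) (S H). a) = of_real (C H)"
    if "H \<in> IK" for H k
    using S_all that by simp_all

  \<comment> \<open>The power sums for H are averages of \<open>T k\<close> over H. Exchanging the
    sums, the Moebius identity cancels every group element except the unit.\<close>
  have sums: "(\<Sum>a\<in>#S0. a ^ k) = (\<Sum>H\<in>IK. of_int (- mu H) * (\<Sum>a\<in>#S H. a ^ k))" for k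
  proof -
    have "(\<Sum>H\<in>IK. of_int (mu H) * (\<Sum>a\<in>#S H. a ^ k))
        = (\<Sum>H\<in>IK. \<Sum>g\<in>carrier G. of_int (mu H) * (of_bool (g \<in> H) / of_nat (card H)) * T k g)"
    proof (intro sum.cong refl)
      fix H assume H: "H \<in> IK"
      have "(\<Sum>g\<in>H. T k g) = (\<Sum>g\<in>carrier G. of_bool (g \<in> H) * T k g)"
        using fin subgroup.subset[OF sub[OF H]] by (intro sum.mono_neutral_cong_left) auto
      then show "of_int (mu H) * (\<Sum>a\<in>#S H. a ^ k)
          = (\<Sum>g\<in>carrier G. of_int (mu H) * (of_bool (g \<in> H) / of_nat (card H)) * T k g)"
        by (simp add: S(1)[OF H] sum_distrib_left sum_divide_distrib mult.assoc)
    qed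
    also have "\<dots> = (\<Sum>g\<in>carrier G. (\<Sum>H\<in>IK. of_int (mu H) * (of_bool (g \<in> H) / of_nat (card H))) * T k g)"
      by (subst sum.swap) (simp add: sum_distrib_right)
    also have "\<dots> = (\<Sum>g\<in>carrier G. - of_bool (g = \<one>\<^bsub>G\<^esub>) * T k g)"
      using G.sum_moebius_irr_kernels[OF fin] unfolding mu_def IK_def by (intro sum.cong refl) simp
    also have "\<dots> = (\<Sum>g\<in>{\<one>\<^bsub>G\<^esub>}. - T k g)"
      using fin by (intro sum.mono_neutral_cong_right) auto
    also have "\<dots> = - (\<Sum>w\<in>verts Y. P k w w)"
      by (simp add: T_def actV.id_eq_one[symmetric])
    finally show ?thesis using S0(1) by (simp add: sum_negf)
  qed
  note det = power_sums_determine_multiset[OF finIK sums]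
  \<comment> \<open>0 is a simple eigenvalue in every spectrum involved, so its multiplicities
    compare to give the total exponent.\<close>
  have mu_sum: "(\<Sum>H\<in>IK. - mu H) = 1"
    using det(1)[of 0] S0(2) S(2) by simp
  have "complex_of_real (real (kappa Y revY) * real n) = of_real (\<Prod>H\<in>IK. C H powi (- mu H))"
    using det(2) S0(3) S(3) by (simp add: of_real_power_int)
  then have main: "real (kappa Y revY) * real n = (\<Prod>H\<in>IK. C H powi (- mu H))"
    by (simp only: of_real_eq_iff)

  define R where "R = (\<Prod>v\<in>verts X. real (base_ramification_index Y X piV piE v))"
  have R: "R \<noteq> 0" unfolding R_def using base_ramification_index_pos by (auto simp: prod_zero_iff)
  define N where "N = real (Coset.order G)"
  have N: "N \<noteq> 0" unfolding N_def using G.order_gt_0_iff_finite fin by simp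
  \<comment> \<open>Each factor of the claim is \<open>C H\<close> times a constant independent of
    H: the vertex weights of the quotient and the order of H are absorbed by
    \<open>C H\<close>.\<close>
  have factor: "real (card (rcosets\<^bsub>G\<^esub> H)) * real (kappa_quotient G phiV phiE Y revY H) /
         ramification_factor G Y X piV piE phiV phiE H = N / (R * real n) * C H" if H: "H \<in> IK" for H
  proof -
    interpret A: inversion_free_action "G\<lparr>carrier := H\<rparr>" Y revY phiV phiE by (rule action[OF H])
    define M where "M = (\<Prod>x\<in>verts A.quot. real (A.quot_ram x))"
    have "M \<noteq> 0" unfolding M_def using A.card_quot_vertex(2) by (auto simp: prod_zero_iff)
    have cardH: "real (card H) \<noteq> 0"
      using A.K.one_closed A.fin by (auto simp: card_eq_0_iff)
    have "real (card (rcosets\<^bsub>G\<^esub> H)) * real (card H) = N"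
      unfolding N_def using G.lagrange[OF sub[OF H]] by (simp flip: of_nat_mult)
    then have index: "real (card (rcosets\<^bsub>G\<^esub> H)) = N / real (card H)"
      using cardH by (simp add: field_simps)
    have kq: "kappa_quotient G phiV phiE Y revY H = kappa A.quot A.quot_rev"
      by (simp add: kappa_quotient_def Let_def)
    have rf: "ramification_factor G Y X piV piE phiV phiE H = R / M"
      by (simp add: ramification_factor_def Let_def R_def M_def A.quot_ram_def)
    have CH: "C H = real (kappa A.quot A.quot_rev) * M * real n / real (card H)"
      unfolding C_def A.quot_const_def M_def n_def by simp
    show ?thesis
      unfolding index kq rf CH using R n \<open>M \<noteq> 0\<close> cardH by (simp add: field_simps)
  qed
  have "(\<Prod>H\<in>IK. (real (card (rcosets\<^bsub>G\<^esub> H)) * real (kappa_quotient G phiV phiE Y revY H) /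
         ramification_factor G Y X piV piE phiV phiE H) powi (- mu H))
      = (\<Prod>H\<in>IK. (N / (R * real n)) powi (- mu H) * C H powi (- mu H))"
    by (intro prod.cong refl) (simp only: factor power_int_mult_distrib)
  \<comment> \<open>The common constant is collected with the sum of all exponents, which is 1 by
    \<open>mu_sum\<close>, and so enters exactly once.\<close>
  also have "\<dots> = (N / (R * real n)) powi (\<Sum>H\<in>IK. - mu H) * (\<Prod>H\<in>IK. C H powi (- mu H))"
    using N R n by (subst power_int_sum) (auto simp: prod.distrib)
  also have "\<dots> = N / (R * real n) * (real (kappa Y revY) * real n)"
    by (simp only: mu_sum main power_int_1_right)
  also have "\<dots> = N / R * real (kappa Y revY)"
    using n by simp
  finally have prod_eq: "(\<Prod>H\<in>irr_kernels G. (real (card (rcosets\<^bsub>G\<^esub> H)) *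
        real (kappa_quotient G phiV phiE Y revY H) /
         ramification_factor G Y X piV piE phiV phiE H)
        powi (- moebius_poset (insert {} (irr_kernels G)) {} H)) = N / R * real (kappa Y revY)"
    unfolding IK_def mu_def .
  show ?thesis
    unfolding prod_eq using N R by (simp add: N_def[symmetric] R_def[symmetric])
qed

end
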